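(* Let $d$ be a positive integer. Let $G$ be the $t$-sum of the graphs $G_1=(V_1,E_1)$ and $G_2=(V_2,E_2)$ along an edge $uv\in E_1\cap E_2$, for some integer $t$ with $2\le t\le d+1$. Then $G$ is an $\mathcal{R}_d$-circuit if and only if $G_i$ contains a unique $\mathcal{R}_d$-circuit $G_i'$ for $i\in\{1,2\}$, and we have $uv\in E(G_1')\cap E(G_2')$ and $G+uv=G_1'\cup G_2'$.
   Context: Graphs are finite and simple, with a nonempty edge set. $G+uv$ is $G$ with the edge $uv$ added; unions and intersections of graphs are taken on both vertex sets and edge sets. A graph containing an $\mathcal{R}_d$-circuit means containing it as a subgraph. A graph $G$ is the $t$-sum of two graphs $G_1$ and $G_2$ along an edge $e\in E(G_1)\cap E(G_2)$ if $G=(G_1\cup G_2)-e$ and $G_1\cap G_2$ is a complete graph on $t$ vertices. Let $G=(V,E)$ be a graph. For $p:V\to\mathbb{C}^d$ put $m_{d,G}(p)=\big(\sum_{i=1}^d(p(u)_i-p(v)_i)^2\big)_{uv\in E}\in\mathbb{C}^E$; $p$ is generic if its $d|V|$ coordinates do not satisfy any nonzero polynomial with rational coefficients. The $d$-dimensional generic rigidity matroid $\mathcal{R}_d(G)$ is the matroid on $E$ given by the rows of the Jacobian matrix of $m_{d,G}$ at any generic $p$ (the result does not depend on the choice of $p$); $r_d(G)$ is its rank. $G$ is $\mathcal{R}_d$-independent if $r_d(G)=|E(G)|$. $G$ is an $\mathcal{R}_d$-circuit if it has no isolated vertices and it is not $\mathcal{R}_d$-independent but every proper subgraph of $G$ is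 $\mathcal{R}_d$-independent.
   Formalization: Assumes in addition that neither G_1 nor G_2 is a subgraph of the other (neither is just the common K_t); otherwise the claim fails, e.g. d=1, t=2, G_1=K_2, G_2=C_4 plus the chord uv: G=C_4 is a circuit but G_1 contains none. *)

theory Defs
  imports
    "HOL-Analysis.Analysis"
    "HOL-Library.Function_Algebras"
    "HOL-Library.Poly_Mapping"
begin

datatype 'a graph = Graph (verts: "'a set") (edges: "'a set set")

definition all_pairs :: "'a set \<Rightarrow> 'a set set" where
  "all_pairs V = {e. e \<subseteq> V \<and> card e = 2}"

text \<open>Graphs are finite, simple and have at least one edge.\<close>

definition is_graph :: "'a graph \<Rightarrow> bool" where
  "is_graph G \<longleftrightarrow> finite (verts G) \<and> edges G \<subseteq> all_pairs (verts G) \<and> edges G \<noteq> {}"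

definition subgraph :: "'a graph \<Rightarrow> 'a graph \<Rightarrow> bool" where
  "subgraph H G \<longleftrightarrow> verts H \<subseteq> verts G \<and> edges H \<subseteq> edges G"

definition graph_union :: "'a graph \<Rightarrow> 'a graph \<Rightarrow> 'a graph" where
  "graph_union G H = Graph (verts G \<union> verts H) (edges G \<union> edges H)"

definition graph_inter :: "'a graph \<Rightarrow> 'a graph \<Rightarrow> 'a graph" where
  "graph_inter G H = Graph (verts G \<inter> verts H) (edges G \<inter> edges H)"

definition add_edge :: "'a graph \<Rightarrow> 'a set \<Rightarrow> 'a graph" where
  "add_edge G e = Graph (verts G) (insert e (edges G))"

definition del_edge :: "'a graph \<Rightarrow> 'a set \<Rightarrow> 'a graph" where
  "del_edge G e = Graph (verts G) (edges G - {e})"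

definition complete_on :: "nat \<Rightarrow> 'a graph \<Rightarrow> bool" where
  "complete_on t G \<longleftrightarrow> finite (verts G) \<and> card (verts G) = t \<and> edges G = all_pairs (verts G)"

definition no_isolated :: "'a graph \<Rightarrow> bool" where
  "no_isolated G \<longleftrightarrow> (\<forall>v\<in>verts G. \<exists>e\<in>edges G. v \<in> e)"

definition t_sum :: "nat \<Rightarrow> 'a graph \<Rightarrow> 'a graph \<Rightarrow> 'a graph \<Rightarrow> 'a set \<Rightarrow> bool" where
  "t_sum t G G1 G2 e \<longleftrightarrow>
     e \<in> edges G1 \<inter> edges G2 \<and>
     G = del_edge (graph_union G1 G2) e \<and>
     complete_on t (graph_inter G1 G2)"

text \<open>A map \<open>p : V \<rightarrow> \<complex>\<^sup>d\<close> is a function \<open>p :: 'a \<Rightarrow> nat \<Rightarrow> complex\<close> of which only the values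
  \<open>p v i\<close> with \<open>v \<in> V\<close> and \<open>i < d\<close> matter. The next constant is the coordinate of the measurement
  map indexed by the edge \<open>e\<close>; it does not depend on the order of the endpoints.\<close>

definition sq_length :: "nat \<Rightarrow> ('a \<Rightarrow> nat \<Rightarrow> complex) \<Rightarrow> 'a set \<Rightarrow> complex" where
  "sq_length d p e =
     (THE z. \<exists>u v. u \<noteq> v \<and> e = {u, v} \<and> z = (\<Sum>i<d. (p u i - p v i)\<^sup>2))"

lemma sq_length_edge:
  assumes "u \<noteq> v"
  shows "sq_length d p {u, v} = (\<Sum>i<d. (p u i - p v i)\<^sup>2)"
  unfolding sq_length_def
proof (rule the_equality)
  show "\<exists>u' v'. u' \<noteq> v' \<and> {u, v} = {u', v'} \<and>
          (\<Sum>i<d. (p u i - p v i)\<^sup>2) = (\<Sum>i<d. (p u' i - p v' i)\<^sup>2)"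
    using assms by blast
qed (auto simp: doubleton_eq_iff power2_commute)

text \<open>Polynomials over \<open>\<rat>\<close> in variables of type \<open>'x\<close>: finitely supported maps from monomials
  (finitely supported exponent vectors) to coefficients.\<close>

type_synonym 'x ratpoly = "('x \<Rightarrow>\<^sub>0 nat) \<Rightarrow>\<^sub>0 rat"

definition poly_vars :: "'x ratpoly \<Rightarrow> 'x set" where
  "poly_vars Q = (\<Union>m\<in>Poly_Mapping.keys Q. Poly_Mapping.keys m)"

definition poly_eval :: "'x ratpoly \<Rightarrow> ('x \<Rightarrow> complex) \<Rightarrow> complex" where
  "poly_eval Q f =
     (\<Sum>m\<in>Poly_Mapping.keys Q. of_rat (Poly_Mapping.lookup Q m) *
        (\<Prod>x\<in>Poly_Mapping.keys m. f x ^ Poly_Mapping.lookup m x))"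

definition generic :: "nat \<Rightarrow> 'a set \<Rightarrow> ('a \<Rightarrow> nat \<Rightarrow> complex) \<Rightarrow> bool" where
  "generic d V p \<longleftrightarrow>
     (\<forall>Q :: ('a \<times> nat) ratpoly. Q \<noteq> 0 \<longrightarrow> poly_vars Q \<subseteq> V \<times> {..<d} \<longrightarrow>
        poly_eval Q (\<lambda>(v, i). p v i) \<noteq> 0)"

text \<open>The row indexed by \<open>e\<close> of the Jacobian matrix at \<open>p\<close>; the columns are indexed by the
  coordinates \<open>(w, i) \<in> V \<times> {..<d}\<close>, and the row is padded with zeros outside this set.\<close>

definition jacobian_row ::
    "nat \<Rightarrow> 'a set \<Rightarrow> ('a \<Rightarrow> nat \<Rightarrow> complex) \<Rightarrow> 'a set \<Rightarrow> 'a \<times> nat \<Rightarrow> complex" where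
  "jacobian_row d V p e = (\<lambda>(w, i).
     if w \<in> V \<and> i < d
     then deriv (\<lambda>z. sq_length d (p(w := (p w)(i := z))) e) (p w i)
     else 0)"

definition jacobian_rank :: "nat \<Rightarrow> 'a graph \<Rightarrow> ('a \<Rightarrow> nat \<Rightarrow> complex) \<Rightarrow> nat" where
  "jacobian_rank d G p =
     vector_space.dim (\<lambda>(c::complex) (f :: 'a \<times> nat \<Rightarrow> complex) x. c * f x)
       (jacobian_row d (verts G) p ` edges G)"

text \<open>The rank of the generic rigidity matroid. The value is the same for every generic \<open>p\<close>, so
  an arbitrary one is chosen.\<close>

definition rigidity_rank :: "nat \<Rightarrow> 'a graph \<Rightarrow> nat" where
  "rigidity_rank d G = jacobian_rank d G (SOME p. generic d (verts G) p)"

definition rigidity_independent :: "nat \<Rightarrow> 'a graph \<Rightarrow> bool" where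
  "rigidity_independent d G \<longleftrightarrow> rigidity_rank d G = card (edges G)"

definition rigidity_circuit :: "nat \<Rightarrow> 'a graph \<Rightarrow> bool" where
  "rigidity_circuit d G \<longleftrightarrow>
     is_graph G \<and> no_isolated G \<and> \<not> rigidity_independent d G \<and>
     (\<forall>H. is_graph H \<and> subgraph H G \<and> H \<noteq> G \<longrightarrow> rigidity_independent d H)"

definition unique_circuit_in :: "nat \<Rightarrow> 'a graph \<Rightarrow> 'a graph \<Rightarrow> bool" where
  "unique_circuit_in d C G \<longleftrightarrow>
     rigidity_circuit d C \<and> subgraph C G \<and>
     (\<forall>C'. rigidity_circuit d C' \<and> subgraph C' G \<longrightarrow> C' = C)"

end

theory Submission imports Defs begin

text \<open>A stress of an edge set is a linear dependency between the rows of the Jacobian matrix indexed by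
its edges. A rigidity circuit is an edge set, covering all vertices, with a nonzero stress such that
no proper subset has one; equivalently its nonzero stresses vanish on none of its edges. The whole
proof is about stresses at one generic point \<open>p\<close> of the vertex set of \<open>G\<close>. This is legitimate because a
dependency that holds at a generic point specializes to every point
(\<open>stress_free_generic\<close>). So independence may be tested at any generic point
(\<open>rigidity_independent_iff\<close>), and it follows from independence at any single point, generic or not.

The hypothesis \<open>t \<le> d + 1\<close> makes the points of the common vertex set \<open>T\<close> affinely independent. Then
every system of forces on \<open>T\<close> that is in equilibrium is resolved by the edges of the complete graph on
\<open>T\<close>, and a stress of \<open>G\<^sub>1 \<union> G\<^sub>2\<close> is the sum of a stress of \<open>G\<^sub>1\<close> and a stress of \<open>G\<^sub>2\<close>
(\<open>stress_split\<close>).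

If \<open>G\<close> is a circuit, both \<open>E\<^sub>i - uv\<close> are proper subsets of its edge set, hence stress-free. The stress
of \<open>G\<close> splits into stresses of \<open>G\<^sub>1\<close> and \<open>G\<^sub>2\<close> with opposite values at \<open>uv\<close>. These values
are nonzero, so the supports of the two stresses are the unique circuits of \<open>G\<^sub>1\<close> and \<open>G\<^sub>2\<close>
(\<open>unique_min_dependent_iff\<close>), and together they cover all edges.

Conversely, the unique circuits yield stresses \<open>\<omega>\<^sub>1\<close> and \<open>\<omega>\<^sub>2\<close> with value \<open>1\<close> at \<open>uv\<close>, and the
stresses of \<open>G\<close> are the multiples of \<open>\<omega>\<^sub>1 - \<omega>\<^sub>2\<close>. The difficulty is that this difference might vanish
at another edge \<open>f\<close> of the complete graph on \<open>T\<close>. To exclude that, \<open>p\<close> is moved on the vertices of \<open>G\<^sub>1\<close> by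
a projective transformation that fixes every point of \<open>T\<close>. It multiplies the value of a stress at an
edge \<open>ij\<close> by \<open>\<mu>\<^sub>i \<mu>\<^sub>j\<close>, where the nonzero values of \<open>\<mu>\<close> may be prescribed on \<open>T\<close> since \<open>T\<close> is affinely independent.
Choosing \<open>\<mu>\<close> so that \<open>uv\<close> and \<open>f\<close> scale differently makes the edges of \<open>G\<close> other than \<open>f\<close> independent
at the new point, and therefore at \<open>p\<close> (\<open>stress_free_union_minus_two_edges\<close>).\<close>

section \<open>Rational polynomials and generic points\<close>

definition monomial_value :: "('x \<Rightarrow>\<^sub>0 nat) \<Rightarrow> ('x \<Rightarrow> complex) \<Rightarrow> complex" where
  "monomial_value m f = (\<Prod>x\<in>Poly_Mapping.keys m. f x ^ Poly_Mapping.lookup m x)"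

lemma monomial_value_superset:
  assumes "finite A" "Poly_Mapping.keys m \<subseteq> A"
  shows "monomial_value m f = (\<Prod>x\<in>A. f x ^ Poly_Mapping.lookup m x)"
  unfolding monomial_value_def
  by (rule prod.mono_neutral_left) (use assms in \<open>auto simp: in_keys_iff\<close>)

lemma monomial_value_add:
  "monomial_value (m + m') f = monomial_value m f * monomial_value m' f"
proof -
  let ?A = "Poly_Mapping.keys m \<union> Poly_Mapping.keys m'"
  have "Poly_Mapping.keys (m + m') \<subseteq> ?A"
    by (rule Poly_Mapping.keys_add)
  then show ?thesis
    using monomial_value_superset[of ?A "m + m'" f] monomial_value_superset[of ?A m f]
      monomial_value_superset[of ?A m' f]
    by (simp add: lookup_add power_add prod.distrib)
qed

lemma poly_eval_superset:
  assumes "finite A" "Poly_Mapping.keys Q \<subseteq> A"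
  shows "poly_eval Q f = (\<Sum>m\<in>A. of_rat (Poly_Mapping.lookup Q m) * monomial_value m f)"
  unfolding poly_eval_def monomial_value_def[symmetric]
  by (rule sum.mono_neutral_left) (use assms in \<open>auto simp: in_keys_iff\<close>)

lemma poly_eval_zero [simp]: "poly_eval 0 f = 0"
  by (simp add: poly_eval_def)

lemma poly_eval_single [simp]:
  "poly_eval (Poly_Mapping.single m a) f = of_rat a * monomial_value m f"
  using poly_eval_superset[of "{m}" "Poly_Mapping.single m a" f] by simp

lemma poly_eval_add: "poly_eval (P + Q) f = poly_eval P f + poly_eval Q f"
proof -
  let ?A = "Poly_Mapping.keys P \<union> Poly_Mapping.keys Q"
  have "Poly_Mapping.keys (P + Q) \<subseteq> ?A"
    by (rule Poly_Mapping.keys_add)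
  then show ?thesis
    using poly_eval_superset[of ?A "P + Q" f] poly_eval_superset[of ?A P f]
      poly_eval_superset[of ?A Q f]
    by (simp add: lookup_add of_rat_add distrib_right sum.distrib)
qed

lemma poly_eval_uminus: "poly_eval (- P) f = - poly_eval P f"
  using poly_eval_add[of P "- P" f] by (simp add: eq_neg_iff_add_eq_0 add.commute)

lemma poly_eval_diff: "poly_eval (P - Q) f = poly_eval P f - poly_eval Q f"
  using poly_eval_add[of P "- Q" f] by (simp add: poly_eval_uminus)

lemma poly_eval_sum: "poly_eval (sum P A) f = (\<Sum>a\<in>A. poly_eval (P a) f)"
  by (induction A rule: infinite_finite_induct) (simp_all add: poly_eval_add)

text \<open>Adding one monomial at a time reduces multiplicativity of evaluation to the product of two monomials.\<close>

lemma ratpoly_induct [case_names zero add]: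
  fixes P :: "'x ratpoly"
  assumes zero: "\<Phi> 0" and add: "\<And>P m a. \<Phi> P \<Longrightarrow> \<Phi> (P + Poly_Mapping.single m a)"
  shows "\<Phi> P"
proof (induction P rule: update_induct)
  case const
  then show ?case by (rule zero)
next
  case (update P m a)
  have "Poly_Mapping.update m a P = P + Poly_Mapping.single m a"
    using update(1) by (intro poly_mapping_eqI)
      (auto simp: lookup_update lookup_add lookup_single in_keys_iff when_def)
  then show ?case using add[OF update(3)] by simp
qed

lemma poly_eval_mult: "poly_eval (P * Q) f = poly_eval P f * poly_eval Q f"
proof -
  have single: "poly_eval (Poly_Mapping.single m a * Q) f = of_rat a * monomial_value m f * poly_eval Q f"
    for m and a :: rat
    by (induction Q rule: ratpoly_induct)
      (simp_all add: distrib_left mult_single poly_eval_add of_rat_mult monomial_value_add)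
  show ?thesis
    by (induction P rule: ratpoly_induct) (simp_all add: distrib_right poly_eval_add single)
qed

lemma poly_vars_diff: "poly_vars (P - Q) \<subseteq> poly_vars P \<union> poly_vars Q"
proof -
  have "Poly_Mapping.keys (P - Q) \<subseteq> Poly_Mapping.keys P \<union> Poly_Mapping.keys Q"
    by (auto simp: in_keys_iff lookup_minus)
  then show ?thesis by (auto simp: poly_vars_def)
qed

lemma poly_vars_mult: "poly_vars (P * Q) \<subseteq> poly_vars P \<union> poly_vars Q"
proof
  fix x assume "x \<in> poly_vars (P * Q)"
  then obtain m where m: "m \<in> Poly_Mapping.keys (P * Q)" "x \<in> Poly_Mapping.keys m"
    by (auto simp: poly_vars_def)
  then obtain a b where "m = a + b" "a \<in> Poly_Mapping.keys P" "b \<in> Poly_Mapping.keys Q"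
    using keys_mult[of P Q] by auto
  then show "x \<in> poly_vars P \<union> poly_vars Q"
    using m(2) Poly_Mapping.keys_add[of a b] by (auto simp: poly_vars_def)
qed

text \<open>The graph of a finitely supported function over its support is a finite set, and a countable set has
only countably many finite subsets.\<close>

lemma countable_poly_mappings:
  fixes X :: "'k set"
  assumes "countable X" "countable (UNIV :: 'v::zero set)"
  shows "countable {m :: 'k \<Rightarrow>\<^sub>0 'v. Poly_Mapping.keys m \<subseteq> X}"
proof -
  define graph where
    "graph m = (\<lambda>k. (k, Poly_Mapping.lookup m k)) ` Poly_Mapping.keys m" for m :: "'k \<Rightarrow>\<^sub>0 'v"
  have "inj graph"
  proof (rule injI)
    fix m m' :: "'k \<Rightarrow>\<^sub>0 'v"
    assume eq: "graph m = graph m'"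
    have mem: "(k, a) \<in> graph n \<longleftrightarrow> a \<noteq> 0 \<and> Poly_Mapping.lookup n k = a" for k a n
      unfolding graph_def by (auto simp: in_keys_iff image_iff)
    show "m = m'"
    proof (rule poly_mapping_eqI)
      fix k
      show "Poly_Mapping.lookup m k = Poly_Mapping.lookup m' k"
        using mem[of k "Poly_Mapping.lookup m k" m] mem[of k "Poly_Mapping.lookup m' k" m']
          mem[of k "Poly_Mapping.lookup m k" m'] mem[of k "Poly_Mapping.lookup m' k" m] eq
        by metis
    qed
  qed
  moreover have "graph ` {m. Poly_Mapping.keys m \<subseteq> X} \<subseteq> {A. finite A \<and> A \<subseteq> X \<times> UNIV}"
    by (auto simp: graph_def)
  moreover have "countable {A. finite A \<and> A \<subseteq> X \<times> (UNIV :: 'v set)}"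
    using assms by (intro countable_Collect_finite_subset countable_SIGMA) auto
  ultimately show ?thesis
    by (meson countable_subset countable_image_inj_on inj_on_subset subset_UNIV)
qed

lemma countable_ratpolys:
  assumes "finite X"
  shows "countable {Q :: 'x ratpoly. poly_vars Q \<subseteq> X}"
proof -
  have "countable {m :: 'x \<Rightarrow>\<^sub>0 nat. Poly_Mapping.keys m \<subseteq> X}"
    using assms by (intro countable_poly_mappings) (auto intro: countable_finite)
  then have "countable {Q :: 'x ratpoly. Poly_Mapping.keys Q \<subseteq> {m. Poly_Mapping.keys m \<subseteq> X}}"
    by (rule countable_poly_mappings) (use countable_rat in auto)
  moreover have "{Q :: 'x ratpoly. poly_vars Q \<subseteq> X}
      = {Q. Poly_Mapping.keys Q \<subseteq> {m. Poly_Mapping.keys m \<subseteq> X}}"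
    by (auto simp: poly_vars_def)
  ultimately show ?thesis by simp
qed

definition algebraically_independent :: "'x set \<Rightarrow> ('x \<Rightarrow> complex) \<Rightarrow> bool" where
  "algebraically_independent X f \<longleftrightarrow> (\<forall>Q. Q \<noteq> 0 \<longrightarrow> poly_vars Q \<subseteq> X \<longrightarrow> poly_eval Q f \<noteq> 0)"

text \<open>Collecting the monomials of \<open>Q\<close> by their exponent of \<open>x\<close> turns the value into a polynomial in \<open>z\<close>
whose coefficients are values at \<open>f\<close> of polynomials in the old variables. At least one of these
polynomials is nonzero, and then so is its value.\<close>

lemma finite_roots_in_new_variable:
  assumes free: "algebraically_independent X f" and Q: "Q \<noteq> 0" "poly_vars Q \<subseteq> insert x X"
  shows "finite {z. poly_eval Q (f(x := z)) = 0}"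
proof -
  let ?K = "Poly_Mapping.keys Q"
  \<comment> \<open>\<open>rest m\<close> is the monomial \<open>m\<close> with \<open>x\<close> set to \<open>1\<close>; \<open>part k\<close> is the coefficient of \<open>x ^ k\<close> in \<open>Q\<close>.\<close>
  define rest where "rest m = Poly_Mapping.update x 0 m" for m :: "'a \<Rightarrow>\<^sub>0 nat"
  define part where
    "part k = (\<Sum>m | m \<in> ?K \<and> Poly_Mapping.lookup m x = k.
       Poly_Mapping.single (rest m) (Poly_Mapping.lookup Q m))" for k
  obtain m0 where m0: "m0 \<in> ?K" using Q(1) by (metis ex_in_conv keys_eq_empty)
  define N where "N = Max ((\<lambda>m. Poly_Mapping.lookup m x) ` ?K)"
  have N: "Poly_Mapping.lookup m x \<le> N" if "m \<in> ?K" for m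
    using that by (simp add: N_def)
  have rest_keys: "Poly_Mapping.keys (rest m) = Poly_Mapping.keys m - {x}" for m
    by (auto simp: rest_def keys_update)
  have split: "monomial_value m (f(x := z)) = monomial_value (rest m) f * z ^ Poly_Mapping.lookup m x"
    for m z
  proof -
    have "monomial_value m (f(x := z))
        = (\<Prod>y\<in>insert x (Poly_Mapping.keys m - {x}). (f(x := z)) y ^ Poly_Mapping.lookup m y)"
      by (rule monomial_value_superset) auto
    also have "\<dots> = z ^ Poly_Mapping.lookup m x *
        (\<Prod>y\<in>Poly_Mapping.keys m - {x}. f y ^ Poly_Mapping.lookup m y)"
      by (subst prod.insert) (auto intro!: prod.cong)
    also have "(\<Prod>y\<in>Poly_Mapping.keys m - {x}. f y ^ Poly_Mapping.lookup m y) = monomial_value (rest m) f"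
      unfolding monomial_value_def rest_keys
      by (rule prod.cong) (auto simp: rest_def lookup_update)
    finally show ?thesis by (simp only: mult.commute)
  qed
  have eval: "poly_eval Q (f(x := z)) = (\<Sum>k\<le>N. poly_eval (part k) f * z ^ k)" for z
  proof -
    have "poly_eval Q (f(x := z))
        = (\<Sum>m\<in>?K. of_rat (Poly_Mapping.lookup Q m) * monomial_value (rest m) f * z ^ Poly_Mapping.lookup m x)"
      by (subst poly_eval_superset[of ?K]) (auto simp: split mult.assoc)
    also have "\<dots> = (\<Sum>k\<le>N. \<Sum>m | m \<in> ?K \<and> Poly_Mapping.lookup m x = k.
        of_rat (Poly_Mapping.lookup Q m) * monomial_value (rest m) f * z ^ Poly_Mapping.lookup m x)"
      by (rule sum.group[symmetric]) (auto simp: N)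
    also have "\<dots> = (\<Sum>k\<le>N. poly_eval (part k) f * z ^ k)"
      unfolding part_def poly_eval_sum sum_distrib_right by (intro sum.cong) auto
    finally show ?thesis .
  qed
  define k where "k = Poly_Mapping.lookup m0 x"
  \<comment> \<open>No other monomial contributes to the coefficient of \<open>rest m0\<close> in \<open>part k\<close>, so nothing cancels.\<close>
  have inj: "m = m0" if "rest m = rest m0" "Poly_Mapping.lookup m x = k" for m
  proof (rule poly_mapping_eqI)
    fix y
    have "Poly_Mapping.lookup (rest m) y = Poly_Mapping.lookup (rest m0) y"
      using that(1) by simp
    then show "Poly_Mapping.lookup m y = Poly_Mapping.lookup m0 y"
      using that(2) unfolding rest_def lookup_update k_def by (auto split: if_splits)
  qed
  have "Poly_Mapping.lookup (part k) (rest m0)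
      = (\<Sum>m | m \<in> ?K \<and> Poly_Mapping.lookup m x = k.
          if m = m0 then Poly_Mapping.lookup Q m0 else 0)"
    unfolding part_def lookup_sum
    by (rule sum.cong) (auto simp: lookup_single when_def dest: inj)
  also have "\<dots> = Poly_Mapping.lookup Q m0"
    by (subst sum.delta) (use m0 in \<open>auto simp: k_def\<close>)
  finally have "part k \<noteq> 0" using m0 by (auto simp: in_keys_iff)
  moreover have "poly_vars (part k) \<subseteq> X"
  proof -
    have "\<exists>n\<in>?K. m = rest n" if "m \<in> Poly_Mapping.keys (part k)" for m
    proof -
      have "(\<Sum>n | n \<in> ?K \<and> Poly_Mapping.lookup n x = k.
          Poly_Mapping.lookup (Poly_Mapping.single (rest n) (Poly_Mapping.lookup Q n)) m) \<noteq> 0"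
        using that by (simp add: in_keys_iff part_def lookup_sum)
      then obtain n where "n \<in> ?K"
        "Poly_Mapping.lookup (Poly_Mapping.single (rest n) (Poly_Mapping.lookup Q n)) m \<noteq> 0"
        by (rule sum.not_neutral_contains_not_neutral) auto
      then show ?thesis by (metis lookup_single_not_eq)
    qed
    then show ?thesis
      using Q(2) rest_keys unfolding poly_vars_def by blast
  qed
  ultimately have "poly_eval (part k) f \<noteq> 0"
    using free by (simp add: algebraically_independent_def)
  moreover have "k \<le> N" using N[OF m0] by (simp add: k_def)
  ultimately show ?thesis
    unfolding eval by (subst polyfun_finite_roots) blast
qed

text \<open>Adjoin one variable at a time: each of the countably many polynomials excludes finitely many values of
the new variable, and the complex numbers are uncountable.\<close>

lemma algebraically_independent_exists:
  assumes "finite X"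
  shows "\<exists>f. algebraically_independent X f"
  using assms
proof (induction X)
  case empty
  have "poly_eval Q f \<noteq> 0" if "Q \<noteq> 0" "poly_vars Q \<subseteq> {}" for Q :: "'a ratpoly" and f
  proof -
    have "Poly_Mapping.keys Q \<subseteq> {0}" using that(2) by (auto simp: poly_vars_def)
    moreover have "Poly_Mapping.keys Q \<noteq> {}" using that(1) by simp
    ultimately have "Poly_Mapping.keys Q = {0}" by blast
    then show ?thesis
      unfolding poly_eval_def by (auto simp: in_keys_iff)
  qed
  then show ?case by (auto simp: algebraically_independent_def)
next
  case (insert x X)
  then obtain f where f: "algebraically_independent X f" by blast
  let ?Qs = "{Q. poly_vars Q \<subseteq> insert x X} - {0}"
  have "countable (\<Union>Q\<in>?Qs. {z. poly_eval Q (f(x := z)) = 0})"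
    using insert.hyps finite_roots_in_new_variable[OF f]
    by (intro countable_UN countable_Diff countable_ratpolys countable_finite) auto
  then obtain z where "z \<notin> (\<Union>Q\<in>?Qs. {z. poly_eval Q (f(x := z)) = 0})"
    using uncountable_UNIV_complex by (metis UNIV_eq_I)
  then have "algebraically_independent (insert x X) (f(x := z))"
    unfolding algebraically_independent_def by blast
  then show ?case by blast
qed

lemma generic_iff_algebraically_independent:
  "generic d V p \<longleftrightarrow> algebraically_independent (V \<times> {..<d}) (\<lambda>(v, i). p v i)"
  by (auto simp: generic_def algebraically_independent_def)

lemma generic_exists:
  assumes "finite V"
  shows "\<exists>p. generic d V p"
proof -
  obtain f where "algebraically_independent (V \<times> {..<d}) f"
    using algebraically_independent_exists[of "V \<times> {..<d}"] assms by auto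
  then have "generic d V (\<lambda>v i. f (v, i))"
    by (simp add: generic_iff_algebraically_independent)
  then show ?thesis by blast
qed

lemma generic_subset: "generic d V p \<Longrightarrow> W \<subseteq> V \<Longrightarrow> generic d W p"
  unfolding generic_def by (meson Sigma_mono order.trans order_refl)

section \<open>Specialization of linear dependencies\<close>

definition lin_dependent :: "'e set \<Rightarrow> 'x set \<Rightarrow> ('e \<Rightarrow> 'x \<Rightarrow> complex) \<Rightarrow> bool" where
  "lin_dependent E X f \<longleftrightarrow>
     (\<exists>c. (\<exists>e\<in>E. c e \<noteq> 0) \<and> (\<forall>x\<in>X. (\<Sum>e\<in>E. c e * f e x) = 0))"

text \<open>\<open>S\<close> relates values in one ring to their images under a specialization, and
rows with entries in the first ring stay dependent after specialization. The proof is fraction-free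
Gaussian elimination carried out on both families at once: the pivot is chosen nonzero in \<open>g\<close>, and then
its preimage in \<open>f\<close> is nonzero too. The elimination step uses only expressions \<open>a * b - c * d\<close>, which is why
closure is required in this form.\<close>

lemma lin_dependent_specializes:
  fixes f g :: "'e \<Rightarrow> 'x \<Rightarrow> complex"
  assumes closed: "\<And>a a' b b' c c' d d'. \<lbrakk>(a, a') \<in> S; (b, b') \<in> S; (c, c') \<in> S; (d, d') \<in> S\<rbrakk>
      \<Longrightarrow> (a * b - c * d, a' * b' - c' * d') \<in> S"
    and zero: "\<And>a. (0, a) \<in> S \<Longrightarrow> a = 0"
    and "finite E" and "\<And>e x. e \<in> E \<Longrightarrow> x \<in> X \<Longrightarrow> (f e x, g e x) \<in> S"
    and "lin_dependent E X f"
  shows "lin_dependent E X g"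
  using assms(3-5)
proof (induction "card E" arbitrary: E f g)
  case 0
  then show ?case by (auto simp: lin_dependent_def)
next
  case (Suc n)
  obtain c where c: "\<exists>e\<in>E. c e \<noteq> 0" "\<And>x. x \<in> X \<Longrightarrow> (\<Sum>e\<in>E. c e * f e x) = 0"
    using Suc.prems(3) by (auto simp: lin_dependent_def)
  show ?case
  proof (cases "\<forall>e\<in>E. \<forall>x\<in>X. g e x = 0")
    case True
    then have "\<forall>x\<in>X. (\<Sum>e\<in>E. 1 * g e x) = 0" by simp
    moreover have "\<exists>e\<in>E. (1::complex) \<noteq> 0" using c(1) by auto
    ultimately show ?thesis unfolding lin_dependent_def by (intro exI[of _ "\<lambda>_. 1"]) simp
  next
    case False
    then obtain e0 x0 where pivot: "e0 \<in> E" "x0 \<in> X" "g e0 x0 \<noteq> 0" by blast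
    have pivot': "f e0 x0 \<noteq> 0"
      using zero[of "g e0 x0"] Suc.prems(2)[OF pivot(1,2)] pivot(3) by auto
    define f' where "f' e x = f e0 x0 * f e x - f e x0 * f e0 x" for e x
    define g' where "g' e x = g e0 x0 * g e x - g e x0 * g e0 x" for e x
    have split: "(\<Sum>e\<in>E. h e) = h e0 + (\<Sum>e\<in>E - {e0}. h e)" for h :: "'e \<Rightarrow> complex"
      using Suc.prems(1) pivot(1) by (simp add: sum.remove)
    have rest: "(\<Sum>e\<in>E - {e0}. c e * f e x) = - (c e0 * f e0 x)" if "x \<in> X" for x
      using c(2)[OF that] split[of "\<lambda>e. c e * f e x"] by (simp add: eq_neg_iff_add_eq_0 add.commute)
    have "lin_dependent (E - {e0}) X f'"
      unfolding lin_dependent_def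
    proof (intro exI[of _ c] conjI ballI)
      show "\<exists>e\<in>E - {e0}. c e \<noteq> 0"
      proof (rule ccontr)
        assume none: "\<not> ?thesis"
        then have "c e0 * f e0 x0 = 0" using rest[OF pivot(2)] by simp
        then show False using none pivot' c(1) by auto
      qed
      fix x assume x: "x \<in> X"
      have "(\<Sum>e\<in>E - {e0}. c e * f' e x)
          = (\<Sum>e\<in>E - {e0}. f e0 x0 * (c e * f e x) - c e * f e x0 * f e0 x)"
        by (rule sum.cong) (simp_all add: f'_def algebra_simps)
      also have "\<dots> = f e0 x0 * (\<Sum>e\<in>E - {e0}. c e * f e x) - (\<Sum>e\<in>E - {e0}. c e * f e x0) * f e0 x"
        by (simp only: sum_subtractf sum_distrib_left sum_distrib_right)
      finally show "(\<Sum>e\<in>E - {e0}. c e * f' e x) = 0"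
        by (simp add: rest x pivot(2))
    qed
    moreover have "(f' e x, g' e x) \<in> S" if "e \<in> E - {e0}" "x \<in> X" for e x
      unfolding f'_def g'_def using that pivot by (intro closed Suc.prems(2)) auto
    moreover have "n = card (E - {e0})" "finite (E - {e0})"
      using Suc.hyps(2) Suc.prems(1) pivot(1) by auto
    ultimately have "lin_dependent (E - {e0}) X g'"
      using Suc.hyps(1)[of "E - {e0}" f' g'] by blast
    then obtain b where b: "\<exists>e\<in>E - {e0}. b e \<noteq> 0"
      "\<And>x. x \<in> X \<Longrightarrow> (\<Sum>e\<in>E - {e0}. b e * g' e x) = 0"
      by (auto simp: lin_dependent_def)
    define a where "a e = (if e = e0 then - (\<Sum>e\<in>E - {e0}. b e * g e x0) else g e0 x0 * b e)" for e
    show ?thesis unfolding lin_dependent_def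
    proof (intro exI[of _ a] conjI ballI)
      show "\<exists>e\<in>E. a e \<noteq> 0" using b(1) pivot(3) by (auto simp: a_def)
      fix x assume x: "x \<in> X"
      have "(\<Sum>e\<in>E. a e * g e x)
          = (\<Sum>e\<in>E - {e0}. g e0 x0 * b e * g e x) - (\<Sum>e\<in>E - {e0}. b e * g e x0) * g e0 x"
        unfolding split by (simp add: a_def)
      also have "\<dots> = (\<Sum>e\<in>E - {e0}. g e0 x0 * b e * g e x - b e * g e x0 * g e0 x)"
        by (simp only: sum_subtractf sum_distrib_right)
      also have "\<dots> = (\<Sum>e\<in>E - {e0}. b e * g' e x)"
        by (rule sum.cong) (simp_all add: g'_def algebra_simps)
      finally show "(\<Sum>e\<in>E. a e * g e x) = 0" using b(2)[OF x] by simp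
    qed
  qed
qed

text \<open>For generic \<open>p\<close> this is the graph of the ring homomorphism that sends the coordinates of \<open>p\<close> to those of
\<open>q\<close>.\<close>

definition specialization :: "nat \<Rightarrow> 'a set \<Rightarrow> ('a \<Rightarrow> nat \<Rightarrow> complex) \<Rightarrow> ('a \<Rightarrow> nat \<Rightarrow> complex) \<Rightarrow>
    (complex \<times> complex) set" where
  "specialization d V p q =
     {(poly_eval Q (\<lambda>(v, i). p v i), poly_eval Q (\<lambda>(v, i). q v i)) | Q.
       poly_vars Q \<subseteq> V \<times> {..<d}}"

lemma specialization_closed:
  assumes "(a, a') \<in> specialization d V p q" "(b, b') \<in> specialization d V p q"
    "(c, c') \<in> specialization d V p q" "(e, e') \<in> specialization d V p q"
  shows "(a * b - c * e, a' * b' - c' * e') \<in> specialization d V p q"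
proof -
  let ?p = "\<lambda>(v, i). p v i" and ?q = "\<lambda>(v, i). q v i"
  obtain A B C D where
    "poly_vars A \<subseteq> V \<times> {..<d}" "a = poly_eval A ?p" "a' = poly_eval A ?q"
    "poly_vars B \<subseteq> V \<times> {..<d}" "b = poly_eval B ?p" "b' = poly_eval B ?q"
    "poly_vars C \<subseteq> V \<times> {..<d}" "c = poly_eval C ?p" "c' = poly_eval C ?q"
    "poly_vars D \<subseteq> V \<times> {..<d}" "e = poly_eval D ?p" "e' = poly_eval D ?q"
    using assms unfolding specialization_def by auto
  moreover from this have "poly_vars (A * B - C * D) \<subseteq> V \<times> {..<d}"
    using poly_vars_diff[of "A * B" "C * D"] poly_vars_mult[of A B] poly_vars_mult[of C D] by blast
  ultimately show ?thesis
    unfolding specialization_def mem_Collect_eq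
    by (intro exI[of _ "A * B - C * D"]) (simp add: poly_eval_diff poly_eval_mult)
qed

lemma specialization_zero:
  assumes "generic d V p" "(0, a) \<in> specialization d V p q"
  shows "a = 0"
proof -
  obtain Q where Q: "poly_vars Q \<subseteq> V \<times> {..<d}" "poly_eval Q (\<lambda>(v, i). p v i) = 0"
    "a = poly_eval Q (\<lambda>(v, i). q v i)"
    using assms(2) unfolding specialization_def mem_Collect_eq by (metis prod.inject)
  then have "Q = 0" using assms(1) unfolding generic_def by blast
  then show ?thesis using Q(3) by simp
qed

lemma specialization_one: "(1, 1) \<in> specialization d V p q"
  unfolding specialization_def
  by (auto simp: poly_vars_def monomial_value_def intro!: exI[of _ "Poly_Mapping.single 0 1"] simp del: single_one)

lemma specialization_coordinate:
  assumes "v \<in> V" "i < d"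
  shows "(p v i, q v i) \<in> specialization d V p q"
  unfolding specialization_def
  using assms
  by (auto simp: poly_vars_def monomial_value_def
      intro!: exI[of _ "Poly_Mapping.single (Poly_Mapping.single (v, i) 1) 1"])

lemma lin_dependent_at_generic:
  assumes "generic d V p" "finite E" "lin_dependent E X f"
    and "\<And>e x. e \<in> E \<Longrightarrow> x \<in> X \<Longrightarrow> (f e x, g e x) \<in> specialization d V p q"
  shows "lin_dependent E X g"
  using lin_dependent_specializes[of "specialization d V p q" E X f g] specialization_closed
    specialization_zero[OF assms(1)] assms by blast

definition affinely_independent :: "nat \<Rightarrow> 'a set \<Rightarrow> ('a \<Rightarrow> nat \<Rightarrow> complex) \<Rightarrow> bool" where
  "affinely_independent d T p \<longleftrightarrow>
     (\<forall>c. (\<Sum>v\<in>T. c v) = 0 \<longrightarrow> (\<forall>i<d. (\<Sum>v\<in>T. c v * p v i) = 0) \<longrightarrow> (\<forall>v\<in>T. c v = 0))"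

text \<open>By specialization it suffices that some placement is affinely independent. The witness sends the first
\<open>d\<close> vertices to the standard basis vectors and a possible last one to the origin. Affine independence
is linear independence of the homogeneous coordinate vectors, whose extra entry \<open>1\<close> has index \<open>d\<close>.\<close>

lemma generic_affinely_independent:
  assumes p: "generic d V p" and T: "T \<subseteq> V" "finite T" "card T \<le> d + 1"
  shows "affinely_independent d T p"
proof (rule ccontr)
  assume "\<not> ?thesis"
  then obtain c where c: "(\<Sum>v\<in>T. c v) = 0" "\<forall>i<d. (\<Sum>v\<in>T. c v * p v i) = 0" "\<exists>v\<in>T. c v \<noteq> 0"
    by (auto simp: affinely_independent_def)
  obtain idx where idx: "bij_betw idx T {..<card T}"
    using ex_bij_betw_finite_nat[OF T(2)] atLeast0LessThan by metis
  then have idx_d: "idx v \<le> d" if "v \<in> T" for v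
    using that T(3) bij_betwE[OF idx] by fastforce
  define q :: "'a \<Rightarrow> nat \<Rightarrow> complex" where "q v i = of_bool (idx v = i)" for v i
  define homog :: "('a \<Rightarrow> nat \<Rightarrow> complex) \<Rightarrow> 'a \<Rightarrow> nat \<Rightarrow> complex" where
    "homog r v k = (if k < d then r v k else 1)" for r v k
  have "lin_dependent T {..d} (homog p)"
    unfolding lin_dependent_def
  proof (intro exI[of _ c] conjI ballI)
    show "(\<Sum>v\<in>T. c v * homog p v k) = 0" for k
      using c(1,2) by (cases "k < d") (simp_all add: homog_def)
  qed (rule c(3))
  then have "lin_dependent T {..d} (homog q)"
    by (rule lin_dependent_at_generic[where q=q, OF p T(2)])
      (use T(1) in \<open>auto simp: homog_def intro: specialization_one specialization_coordinate\<close>)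
  then obtain a where a: "\<exists>v\<in>T. a v \<noteq> 0" "\<And>k. k \<le> d \<Longrightarrow> (\<Sum>v\<in>T. a v * homog q v k) = 0"
    by (auto simp: lin_dependent_def)
  have small: "a v = 0" if v: "v \<in> T" "idx v < d" for v
  proof -
    have "(\<Sum>w\<in>T. a w * homog q w (idx v)) = (\<Sum>w\<in>T. if w = v then a v else 0)"
      using v idx by (intro sum.cong) (auto simp: homog_def q_def bij_betw_def inj_on_def)
    then show ?thesis using a(2)[of "idx v"] v T(2) by simp
  qed
  obtain v where v: "v \<in> T" "a v \<noteq> 0" using a(1) by blast
  then have "idx v = d" using small[OF v(1)] idx_d[OF v(1)] by force
  have "a w = 0" if "w \<in> T" "w \<noteq> v" for w
    using small[OF that(1)] idx_d[OF that(1)] \<open>idx v = d\<close> that v(1) idx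
    by (fastforce simp: bij_betw_def inj_on_def)
  then have "(\<Sum>w\<in>T. a w * homog q w d) = (\<Sum>w\<in>T. if w = v then a v else 0)"
    by (intro sum.cong) (auto simp: homog_def)
  then show False using a(2)[of d] v T(2) by simp
qed

section \<open>Stresses and the rigidity matroid\<close>

text \<open>Half of the row of the Jacobian matrix indexed by \<open>e\<close>. For \<open>w \<in> e\<close> the term \<open>j = w\<close> of the sum vanishes,
so the sum is the difference between \<open>p w\<close> and the position of the other endpoint.\<close>

definition edge_row :: "('a \<Rightarrow> nat \<Rightarrow> complex) \<Rightarrow> 'a set \<Rightarrow> 'a \<Rightarrow> nat \<Rightarrow> complex" where
  "edge_row p e w i = (if w \<in> e then \<Sum>j\<in>e. p w i - p j i else 0)"

text \<open>Stresses vanish outside their edge set, so that they can be compared across different edge sets.\<close>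

definition stress ::
    "nat \<Rightarrow> ('a \<Rightarrow> nat \<Rightarrow> complex) \<Rightarrow> 'a set set \<Rightarrow> ('a set \<Rightarrow> complex) \<Rightarrow> bool" where
  "stress d p E \<omega> \<longleftrightarrow> (\<forall>e. e \<notin> E \<longrightarrow> \<omega> e = 0) \<and>
     (\<forall>w. \<forall>i<d. (\<Sum>e\<in>E. \<omega> e * edge_row p e w i) = 0)"

definition stress_free :: "nat \<Rightarrow> ('a \<Rightarrow> nat \<Rightarrow> complex) \<Rightarrow> 'a set set \<Rightarrow> bool" where
  "stress_free d p E \<longleftrightarrow> (\<forall>\<omega>. stress d p E \<omega> \<longrightarrow> (\<forall>e. \<omega> e = 0))"

lemma edge_row_pair:
  assumes "u \<noteq> v"
  shows "edge_row p {u, v} w i =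
    (if w = u then p u i - p v i else if w = v then p v i - p u i else 0)"
  using assms by (auto simp: edge_row_def)

lemma all_pairsE:
  assumes "e \<in> all_pairs V"
  obtains u v where "u \<noteq> v" "e = {u, v}" "u \<in> V" "v \<in> V"
  using assms by (auto simp: all_pairs_def card_2_iff)

lemma other_endpoint:
  assumes "e \<in> all_pairs V" "w \<in> e"
  obtains z where "z \<noteq> w" "e = {w, z}" "w \<in> V" "z \<in> V"
proof -
  obtain u v where "u \<noteq> v" "e = {u, v}" "u \<in> V" "v \<in> V" using assms(1) by (rule all_pairsE)
  then show thesis using assms(2) that[of u] that[of v] by (cases "w = u") auto
qed

lemma jacobian_row_eq:
  assumes e: "e \<in> all_pairs V" and w: "w \<in> V" "i < d"
  shows "jacobian_row d V p e (w, i) = 2 * edge_row p e w i"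
proof -
  obtain u v where uv: "u \<noteq> v" "e = {u, v}" using e by (rule all_pairsE)
  let ?x = "p w i"
  let ?d = "\<lambda>a. if a = w then 1 else 0 :: complex"
  have "((\<lambda>z. \<Sum>k<d. ((p(w := (p w)(i := z))) u k - (p(w := (p w)(i := z))) v k)\<^sup>2)
     has_field_derivative (\<Sum>k<d. if k = i then 2 * (p u i - p v i) * (?d u - ?d v) else 0)) (at ?x)"
  proof (rule DERIV_sum)
    fix k
    have coord: "((\<lambda>z. (p(w := (p w)(i := z))) a k) has_field_derivative
        (if k = i then ?d a else 0)) (at ?x)" for a
      by (cases "a = w"; cases "k = i") auto
    have val: "(p(w := (p w)(i := ?x))) a k = p a k" for a by simp
    show "((\<lambda>z. ((p(w := (p w)(i := z))) u k - (p(w := (p w)(i := z))) v k)\<^sup>2)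
        has_field_derivative (if k = i then 2 * (p u i - p v i) * (?d u - ?d v) else 0)) (at ?x)"
      by (rule DERIV_cong[OF DERIV_power[OF DERIV_diff[OF coord[of u] coord[of v]]]])
        (auto simp: val)
  qed
  then have "jacobian_row d V p e (w, i) = 2 * (p u i - p v i) * (?d u - ?d v)"
    unfolding jacobian_row_def using w uv by (simp add: sq_length_edge DERIV_imp_deriv)
  then show ?thesis using uv by (auto simp: edge_row_pair)
qed

lemma edge_row_outside:
  assumes "e \<in> all_pairs V" "w \<notin> V"
  shows "edge_row p e w i = 0"
  using assms by (auto simp: edge_row_def all_pairs_def)

lemma finite_all_pairs: "finite V \<Longrightarrow> finite (all_pairs V)"
  by (rule finite_subset[of _ "Pow V"]) (auto simp: all_pairs_def)

lemma not_stress_free_iff: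
  assumes E: "E \<subseteq> all_pairs V"
  shows "\<not> stress_free d p E \<longleftrightarrow>
    lin_dependent E (V \<times> {..<d}) (\<lambda>e (w, i). edge_row p e w i)"
proof
  assume "\<not> stress_free d p E"
  then obtain \<omega> e where "stress d p E \<omega>" "\<omega> e \<noteq> 0" by (auto simp: stress_free_def)
  then show "lin_dependent E (V \<times> {..<d}) (\<lambda>e (w, i). edge_row p e w i)"
    unfolding lin_dependent_def stress_def by (intro exI[of _ \<omega>]) auto
next
  assume "lin_dependent E (V \<times> {..<d}) (\<lambda>e (w, i). edge_row p e w i)"
  then obtain c where c: "\<exists>e\<in>E. c e \<noteq> 0"
    "\<And>w i. w \<in> V \<Longrightarrow> i < d \<Longrightarrow> (\<Sum>e\<in>E. c e * edge_row p e w i) = 0"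
    by (auto simp: lin_dependent_def)
  have "stress d p E (\<lambda>e. if e \<in> E then c e else 0)"
    unfolding stress_def
  proof (intro conjI allI impI)
    fix w i assume i: "i < d"
    have "(\<Sum>e\<in>E. (if e \<in> E then c e else 0) * edge_row p e w i) = (\<Sum>e\<in>E. c e * edge_row p e w i)"
      by (rule sum.cong) auto
    also have "\<dots> = 0"
    proof (cases "w \<in> V")
      case False
      then show ?thesis using E by (intro sum.neutral) (auto simp: edge_row_outside[of _ V])
    qed (use c(2) i in auto)
    finally show "(\<Sum>e\<in>E. (if e \<in> E then c e else 0) * edge_row p e w i) = 0" .
  qed simp
  moreover obtain e where "e \<in> E" "c e \<noteq> 0" using c(1) by blast
  then have "(if e \<in> E then c e else 0) \<noteq> 0" by simp
  ultimately show "\<not> stress_free d p E"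
    unfolding stress_free_def by (metis (mono_tags, lifting))
qed

text \<open>The vector space in which the rank of the Jacobian matrix is defined.\<close>

interpretation coord_space: vector_space "\<lambda>(c::complex) (f :: 'x \<Rightarrow> complex) x. c * f x"
  by unfold_locales (auto simp: algebra_simps)

lemma sum_pointwise: "(sum f A) x = (\<Sum>a\<in>A. f a x)" for f :: "'e \<Rightarrow> 'x \<Rightarrow> complex"
  by (induction A rule: infinite_finite_induct) auto

lemma independent_image:
  fixes f :: "'e \<Rightarrow> 'x \<Rightarrow> complex"
  assumes "finite E" and indep: "\<not> lin_dependent E UNIV f"
  shows "inj_on f E" "coord_space.independent (f ` E)"
proof -
  have zero: "c e = 0" if "\<And>x. (\<Sum>e\<in>E. c e * f e x) = 0" "e \<in> E" for c e
    using that indep by (auto simp: lin_dependent_def)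
  show inj: "inj_on f E"
  proof (rule inj_onI, rule ccontr)
    fix e e' assume e: "e \<in> E" "e' \<in> E" "f e = f e'" "e \<noteq> e'"
    have "(\<Sum>g\<in>E. (of_bool (g = e) - of_bool (g = e')) * f g x) = 0" for x
    proof -
      have "(\<Sum>g\<in>E. (of_bool (g = e) - of_bool (g = e')) * f g x)
          = (\<Sum>g\<in>E. if g = e then f e x else 0) - (\<Sum>g\<in>E. if g = e' then f e' x else 0)"
        unfolding sum_subtractf[symmetric] by (rule sum.cong) auto
      then show ?thesis using e assms(1) by simp
    qed
    then show False using zero[of "\<lambda>g. of_bool (g = e) - of_bool (g = e')" e] e by simp
  qed
  show "coord_space.independent (f ` E)"
  proof
    assume "coord_space.dependent (f ` E)"
    then obtain b where b: "\<exists>g\<in>f ` E. b g \<noteq> 0" "(\<Sum>g\<in>f ` E. (\<lambda>x. b g * g x)) = 0"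
      using assms(1) by (subst (asm) coord_space.dependent_finite) auto
    have "(\<Sum>e\<in>E. b (f e) * f e x) = 0" for x
      using fun_cong[OF b(2), of x] by (simp add: sum.reindex[OF inj] sum_pointwise)
    then show False using zero[of "\<lambda>e. b (f e)"] b(1) by auto
  qed
qed

text \<open>Repeated rows count as a dependency of the family, in accordance with the cardinality of the index set
\<open>E\<close>, not that of the image, on the left-hand side.\<close>

lemma dim_image_eq_card_iff:
  fixes f :: "'e \<Rightarrow> 'x \<Rightarrow> complex"
  assumes "finite E"
  shows "coord_space.dim (f ` E) = card E \<longleftrightarrow> \<not> lin_dependent E UNIV f"
proof
  assume dim: "coord_space.dim (f ` E) = card E"
  have inj: "inj_on f E"
  proof (rule eq_card_imp_inj_on[OF assms])
    show "card (f ` E) = card E"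
      using coord_space.dim_le_card'[OF finite_imageI[OF assms, of f]] card_image_le[OF assms, of f] dim
      by linarith
  qed
  have indep: "coord_space.independent (f ` E)"
  proof
    assume "coord_space.dependent (f ` E)"
    then obtain a where a: "a \<in> f ` E" "a \<in> coord_space.span (f ` E - {a})"
      by (auto simp: coord_space.dependent_def)
    have "f ` E \<subseteq> coord_space.span (f ` E - {a})"
    proof
      fix g assume "g \<in> f ` E"
      then show "g \<in> coord_space.span (f ` E - {a})"
        using a(2) coord_space.span_base[of g "f ` E - {a}"] by (cases "g = a") auto
    qed
    then have "coord_space.dim (f ` E) \<le> card (f ` E - {a})"
      using assms by (intro coord_space.dim_le_card) auto
    also have "\<dots> < card (f ` E)"
      using a(1) assms by (intro psubset_card_mono) auto
    finally show False using dim card_image_le[OF assms, of f] by simp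
  qed
  show "\<not> lin_dependent E UNIV f"
  proof
    assume "lin_dependent E UNIV f"
    then obtain c where c: "\<exists>e\<in>E. c e \<noteq> 0" "\<And>x. (\<Sum>e\<in>E. c e * f e x) = 0"
      by (auto simp: lin_dependent_def)
    define b where "b g = c (inv_into E f g)" for g
    have "(\<Sum>g\<in>f ` E. (\<lambda>x. b g * g x)) = (\<Sum>e\<in>E. (\<lambda>x. c e * f e x))"
      by (subst sum.reindex[OF inj]) (simp add: b_def inj)
    also have "\<dots> = 0"
      by (rule ext) (simp add: sum_pointwise c(2))
    finally have "\<forall>g\<in>f ` E. b g = 0"
      using indep assms by (subst (asm) coord_space.dependent_finite) auto
    then show False using c(1) by (auto simp: b_def inj)
  qed
next
  assume "\<not> lin_dependent E UNIV f"
  then show "coord_space.dim (f ` E) = card E"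
    using independent_image[OF assms, of f]
    by (metis coord_space.dim_eq_card_independent card_image)
qed

lemma jacobian_rank_full_iff:
  assumes "finite (verts H)" "edges H \<subseteq> all_pairs (verts H)"
  shows "jacobian_rank d H p = card (edges H) \<longleftrightarrow> stress_free d p (edges H)"
proof -
  let ?V = "verts H" and ?E = "edges H" and ?X = "verts H \<times> {..<d}"
  have E: "finite ?E" using assms finite_all_pairs finite_subset by blast
  have "lin_dependent ?E UNIV (jacobian_row d ?V p)
      \<longleftrightarrow> lin_dependent ?E ?X (\<lambda>e (w, i). edge_row p e w i)"
  proof -
    have out: "jacobian_row d ?V p e x = 0" if "x \<notin> ?X" for e x
      using that by (cases x) (auto simp: jacobian_row_def)
    have ins: "(\<Sum>e\<in>?E. c e * jacobian_row d ?V p e x) = 2 * (\<Sum>e\<in>?E. c e * (case x of (w, i) \<Rightarrow> edge_row p e w i))"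
      if "x \<in> ?X" for c x
      unfolding sum_distrib_left using that assms(2)
      by (intro sum.cong) (auto simp: jacobian_row_eq subset_iff)
    have "(\<forall>x. (\<Sum>e\<in>?E. c e * jacobian_row d ?V p e x) = 0)
       \<longleftrightarrow> (\<forall>x\<in>?X. (\<Sum>e\<in>?E. c e * (case x of (w, i) \<Rightarrow> edge_row p e w i)) = 0)" for c
    proof (intro iffI ballI allI)
      fix x assume "\<forall>x. (\<Sum>e\<in>?E. c e * jacobian_row d ?V p e x) = 0" and x: "x \<in> ?X"
      then have "(\<Sum>e\<in>?E. c e * jacobian_row d ?V p e x) = 0" by blast
      then show "(\<Sum>e\<in>?E. c e * (case x of (w, i) \<Rightarrow> edge_row p e w i)) = 0"
        using ins[OF x, of c] by simp
    next
      fix x assume "\<forall>x\<in>?X. (\<Sum>e\<in>?E. c e * (case x of (w, i) \<Rightarrow> edge_row p e w i)) = 0"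
      then show "(\<Sum>e\<in>?E. c e * jacobian_row d ?V p e x) = 0"
        using ins[of x c] out[of x] by (cases "x \<in> ?X") auto
    qed
    then show ?thesis by (simp add: lin_dependent_def)
  qed
  then show ?thesis
    unfolding jacobian_rank_def dim_image_eq_card_iff[OF E] not_stress_free_iff[OF assms(2), symmetric]
    by simp
qed

text \<open>The entries of the rows are polynomials in the coordinates, so dependent rows at the generic point
\<open>p\<close> specialize to dependent rows at \<open>q\<close>.\<close>

lemma stress_free_generic:
  assumes p: "generic d V p" and V: "finite V" "E \<subseteq> all_pairs V" and q: "stress_free d q E"
  shows "stress_free d p E"
proof (rule ccontr)
  assume "\<not> ?thesis"
  then have dep: "lin_dependent E (V \<times> {..<d}) (\<lambda>e (w, i). edge_row p e w i)"
    by (simp add: not_stress_free_iff[OF V(2)])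
  have diff: "(a - b, a' - b') \<in> specialization d V p q"
    if "(a, a') \<in> specialization d V p q" "(b, b') \<in> specialization d V p q" for a a' b b'
    using specialization_closed[OF that(1) specialization_one that(2) specialization_one] by simp
  have "lin_dependent E (V \<times> {..<d}) (\<lambda>e (w, i). edge_row q e w i)"
  proof (rule lin_dependent_at_generic[where q=q, OF p _ dep])
    show "finite E" using V finite_all_pairs finite_subset by blast
    fix e x assume "e \<in> E" and x: "x \<in> V \<times> {..<d}"
    then obtain u v where uv: "u \<noteq> v" "e = {u, v}" "u \<in> V" "v \<in> V"
      using V(2) by (blast elim: all_pairsE)
    obtain w i where wi: "x = (w, i)" "w \<in> V" "i < d" using x by auto
    have zero: "(0, 0) \<in> specialization d V p q"
      using diff[OF specialization_one specialization_one] by simp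
    show "(case x of (w, i) \<Rightarrow> edge_row p e w i, case x of (w, i) \<Rightarrow> edge_row q e w i)
        \<in> specialization d V p q"
      using wi uv by (auto simp: edge_row_pair intro!: diff specialization_coordinate zero)
  qed
  then show False using q by (simp add: not_stress_free_iff[OF V(2), symmetric])
qed

text \<open>Any generic point may be used in place of the one chosen in the definition of the rank.\<close>

lemma rigidity_independent_iff:
  assumes p: "generic d (verts H) p" and H: "finite (verts H)" "edges H \<subseteq> all_pairs (verts H)"
  shows "rigidity_independent d H \<longleftrightarrow> stress_free d p (edges H)"
proof -
  let ?q = "SOME p. generic d (verts H) p"
  have "generic d (verts H) ?q" using generic_exists[OF H(1)] by (rule someI_ex)
  then have "stress_free d ?q (edges H) \<longleftrightarrow> stress_free d p (edges H)"
    using stress_free_generic[OF _ H] p by blast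
  then show ?thesis
    unfolding rigidity_independent_def rigidity_rank_def jacobian_rank_full_iff[OF H] .
qed

section \<open>Resolving equilibrium loads\<close>

text \<open>The homogeneous coordinate vectors of the points of \<open>T\<close> are linearly independent, so a linear
functional may be prescribed on them; its restriction to the hyperplane of points is the affine function.\<close>

lemma dual_affine_function:
  assumes indep: "affinely_independent d T p" and T: "finite T" "x \<in> T"
  obtains a0 :: complex and y :: "nat \<Rightarrow> complex" where
    "\<And>v. v \<in> T \<Longrightarrow> a0 + (\<Sum>k<d. y k * p v k) = of_bool (v = x)"
proof -
  define h where "h v k = (if k < d then p v k else of_bool (k = d))" for v k
  have zero: "\<forall>v\<in>T. c v = 0" if "\<And>k. (\<Sum>v\<in>T. c v * h v k) = 0" for c
  proof -
    have "(\<Sum>v\<in>T. c v) = 0" using that[of d] by (simp add: h_def)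
    moreover have "(\<Sum>v\<in>T. c v * p v i) = 0" if "i < d" for i
      using \<open>\<And>k. (\<Sum>v\<in>T. c v * h v k) = 0\<close>[of i] that by (simp add: h_def)
    ultimately show ?thesis using indep by (simp add: affinely_independent_def)
  qed
  have free: "\<not> lin_dependent T UNIV h"
    unfolding lin_dependent_def using zero by blast
  interpret vector_space_pair "\<lambda>(c::complex) (f :: nat \<Rightarrow> complex) k. c * f k" "(*) :: complex \<Rightarrow> _"
    by (intro vector_space_pair.intro coord_space.vector_space_axioms vector_space.intro)
      (simp_all add: algebra_simps)
  obtain g where g: "Vector_Spaces.linear (\<lambda>(c::complex) (f :: nat \<Rightarrow> complex) k. c * f k) (*) g"
    and gh: "\<forall>b\<in>h ` T. g b = of_bool (b = h x)"
    using linear_independent_extend[OF independent_image(2)[OF T(1) free], of "\<lambda>b. of_bool (b = h x)"] by blast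
  define y where "y k = g (\<lambda>j. of_bool (j = k))" for k
  have y: "(\<Sum>k\<le>d. y k * h v k) = of_bool (v = x)" if v: "v \<in> T" for v
  proof -
    have "h v = (\<Sum>k\<le>d. (\<lambda>j. h v k * of_bool (j = k)))"
    proof
      fix j
      have "(\<Sum>k\<le>d. h v k * of_bool (j = k)) = (\<Sum>k\<le>d. if k = j then h v j else 0)"
        by (rule sum.cong) auto
      then show "h v j = (\<Sum>k\<le>d. (\<lambda>j. h v k * of_bool (j = k))) j"
        by (simp add: sum_pointwise h_def)
    qed
    then have "g (h v) = (\<Sum>k\<le>d. g (\<lambda>j. h v k * of_bool (j = k)))"
      using linear_sum[OF g] by metis
    also have "\<dots> = (\<Sum>k\<le>d. y k * h v k)"
      by (rule sum.cong) (simp_all add: y_def linear_scale[OF g] mult.commute)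
    finally have "(\<Sum>k\<le>d. y k * h v k) = of_bool (h v = h x)"
      using gh v by simp
    also have "h v = h x \<longleftrightarrow> v = x"
      using inj_on_eq_iff[OF independent_image(1)[OF T(1) free] v T(2)] .
    finally show ?thesis .
  qed
  show thesis
  proof (rule that[of "y d" y])
    fix v assume "v \<in> T"
    have "(\<Sum>k\<le>d. y k * h v k) = (\<Sum>k<d. y k * p v k) + y d"
      by (simp add: lessThan_Suc_atMost[symmetric] h_def)
    then show "y d + (\<Sum>k<d. y k * p v k) = of_bool (v = x)"
      using y[OF \<open>v \<in> T\<close>] by simp
  qed
qed

text \<open>Forces \<open>F w\<close> acting at the points \<open>p w\<close> with vanishing resultant and vanishing total torque; the
torque vanishes iff the matrix \<open>\<Sum>w. F w \<otimes> p w\<close> is symmetric.\<close>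

definition equilibrium_load ::
    "nat \<Rightarrow> ('a \<Rightarrow> nat \<Rightarrow> complex) \<Rightarrow> 'a set \<Rightarrow> ('a \<Rightarrow> nat \<Rightarrow> complex) \<Rightarrow> bool" where
  "equilibrium_load d p V F \<longleftrightarrow>
     (\<forall>i<d. (\<Sum>w\<in>V. F w i) = 0) \<and>
     (\<forall>i<d. \<forall>k<d. (\<Sum>w\<in>V. F w i * p w k) = (\<Sum>w\<in>V. F w k * p w i))"

lemma equilibrium_load_edge_row:
  assumes "finite V" "e \<in> all_pairs V"
  shows "equilibrium_load d p V (edge_row p e)"
proof -
  obtain u v where uv: "u \<noteq> v" "e = {u, v}" "u \<in> V" "v \<in> V" using assms(2) by (rule all_pairsE)
  have sum: "(\<Sum>w\<in>V. edge_row p e w i * g w) = (p u i - p v i) * (g u - g v)" for i and g :: "'a \<Rightarrow> complex"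
  proof -
    have "(\<Sum>w\<in>V. edge_row p e w i * g w) = (\<Sum>w\<in>{u, v}. edge_row p e w i * g w)"
      using assms(1) uv by (intro sum.mono_neutral_right) (auto simp: edge_row_def)
    then show ?thesis using uv by (simp add: edge_row_pair algebra_simps)
  qed
  show ?thesis
    unfolding equilibrium_load_def sum using sum[of _ "\<lambda>_. 1"] by (simp add: mult.commute)
qed

lemma equilibrium_load_add:
  assumes "equilibrium_load d p V F" "equilibrium_load d p V F'"
  shows "equilibrium_load d p V (\<lambda>w i. F w i + F' w i)"
  using assms by (simp add: equilibrium_load_def sum.distrib distrib_right)

lemma equilibrium_load_sum:
  fixes F :: "'e \<Rightarrow> 'a \<Rightarrow> nat \<Rightarrow> complex"
  assumes "\<And>e. e \<in> E \<Longrightarrow> equilibrium_load d p V (F e)"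
  shows "equilibrium_load d p V (\<lambda>w i. \<Sum>e\<in>E. c e * F e w i)"
proof -
  have swap: "(\<Sum>w\<in>V. (\<Sum>e\<in>E. c e * F e w i) * g w) = (\<Sum>e\<in>E. c e * (\<Sum>w\<in>V. F e w i * g w))"
    for i and g :: "'a \<Rightarrow> complex"
  proof -
    have "(\<Sum>w\<in>V. (\<Sum>e\<in>E. c e * F e w i) * g w) = (\<Sum>w\<in>V. \<Sum>e\<in>E. c e * (F e w i * g w))"
      by (simp add: sum_distrib_right mult.assoc)
    also have "\<dots> = (\<Sum>e\<in>E. \<Sum>w\<in>V. c e * (F e w i * g w))" by (rule sum.swap)
    finally show ?thesis by (simp add: sum_distrib_left)
  qed
  show ?thesis
    unfolding equilibrium_load_def
  proof (intro conjI allI impI)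
    fix i assume i: "i < d"
    show "(\<Sum>w\<in>V. \<Sum>e\<in>E. c e * F e w i) = 0"
      using swap[of i "\<lambda>_. 1"] assms i by (simp add: equilibrium_load_def)
    fix k assume k: "k < d"
    show "(\<Sum>w\<in>V. (\<Sum>e\<in>E. c e * F e w i) * p w k) = (\<Sum>w\<in>V. (\<Sum>e\<in>E. c e * F e w k) * p w i)"
      unfolding swap using assms i k by (intro sum.cong) (auto simp: equilibrium_load_def)
  qed
qed

lemma all_pairs_insert:
  "all_pairs (insert x T) = all_pairs T \<union> (\<lambda>v. {x, v}) ` (T - {x})"
proof (intro set_eqI iffI)
  fix e assume "e \<in> all_pairs (insert x T)"
  then obtain u v where "u \<noteq> v" "e = {u, v}" "u \<in> insert x T" "v \<in> insert x T" by (rule all_pairsE)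
  then show "e \<in> all_pairs T \<union> (\<lambda>v. {x, v}) ` (T - {x})"
    by (auto simp: all_pairs_def doubleton_eq_iff image_iff)
qed (auto simp: all_pairs_def)

lemma affinely_independent_subset:
  assumes "affinely_independent d T p" "S \<subseteq> T" "finite T"
  shows "affinely_independent d S p"
  unfolding affinely_independent_def
proof (intro allI impI)
  fix c assume c: "(\<Sum>v\<in>S. c v) = 0" "\<forall>i<d. (\<Sum>v\<in>S. c v * p v i) = 0"
  let ?c = "\<lambda>v. if v \<in> S then c v else 0"
  have eq: "(\<Sum>v\<in>T. ?c v * g v) = (\<Sum>v\<in>S. c v * g v)" for g
    using assms(2,3) by (intro sum.mono_neutral_cong_right) auto
  have "(\<Sum>v\<in>T. ?c v) = 0" using eq[of "\<lambda>_. 1"] c(1) by simp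
  moreover have "\<forall>i<d. (\<Sum>v\<in>T. ?c v * p v i) = 0"
    unfolding eq by (rule c(2))
  ultimately have "\<forall>v\<in>T. ?c v = 0"
    using assms(1) unfolding affinely_independent_def by blast
  then show "\<forall>v\<in>S. c v = 0" using assms(2) by (metis subsetD)
qed

text \<open>Remove one vertex \<open>x\<close> at a time. Let \<open>a\<close> be the affine function, with linear part \<open>y\<close>, that is \<open>1\<close> at \<open>x\<close> and \<open>0\<close> at
the other points. Pairing the load with \<open>a\<close> isolates the force at \<open>x\<close>, and the symmetry of the torque matrix
rewrites the result as \<open>\<Sum>v. \<beta> v * p v\<close> with \<open>\<Sum>v. \<beta> v = 0\<close>, that is, as a combination of the edge vectors at
\<open>x\<close>. Cancelling it by the edges at \<open>x\<close> leaves an equilibrium load on the other vertices.\<close>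

lemma load_resolved_by_complete_graph:
  assumes "finite T" "affinely_independent d T p" "equilibrium_load d p T F"
  shows "\<exists>\<kappa>. \<forall>w\<in>T. \<forall>i<d. F w i = (\<Sum>e\<in>all_pairs T. \<kappa> e * edge_row p e w i)"
  using assms
proof (induction T arbitrary: F)
  case empty
  then show ?case by simp
next
  case (insert x T)
  obtain a0 y where a: "\<And>v. v \<in> insert x T \<Longrightarrow> a0 + (\<Sum>k<d. y k * p v k) = of_bool (v = x)"
    using dual_affine_function[OF insert.prems(1)] insert.hyps(1) by blast
  define \<beta> where "\<beta> v = (\<Sum>k<d. y k * F v k)" for v
  have total: "(\<Sum>v\<in>insert x T. F v i) = 0" if "i < d" for i
    using insert.prems(2) that unfolding equilibrium_load_def by blast
  have sym: "(\<Sum>v\<in>insert x T. F v i * p v k) = (\<Sum>v\<in>insert x T. F v k * p v i)"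
    if "i < d" "k < d" for i k
    using insert.prems(2) that unfolding equilibrium_load_def by blast
  have \<beta>_total: "(\<Sum>v\<in>insert x T. \<beta> v) = 0"
  proof -
    have "(\<Sum>v\<in>insert x T. \<beta> v) = (\<Sum>k<d. y k * (\<Sum>v\<in>insert x T. F v k))"
      unfolding \<beta>_def sum_distrib_left by (rule sum.swap)
    also have "\<dots> = 0" by (rule sum.neutral) (simp del: sum.insert add: total)
    finally show ?thesis .
  qed
  have force: "F x i = - (\<Sum>v\<in>T. \<beta> v * (p x i - p v i))" if i: "i < d" for i
  proof -
    have "F x i = (\<Sum>v\<in>insert x T. F v i * of_bool (v = x))"
      using insert.hyps by (simp add: sum.neutral)
    also have "\<dots> = (\<Sum>v\<in>insert x T. F v i * (a0 + (\<Sum>k<d. y k * p v k)))"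
      by (rule sum.cong) (simp_all only: a)
    also have "\<dots> = a0 * (\<Sum>v\<in>insert x T. F v i) + (\<Sum>v\<in>insert x T. \<Sum>k<d. y k * (F v i * p v k))"
      by (simp only: distrib_left sum.distrib sum_distrib_left mult.commute mult.left_commute)
    also have "(\<Sum>v\<in>insert x T. \<Sum>k<d. y k * (F v i * p v k))
        = (\<Sum>k<d. y k * (\<Sum>v\<in>insert x T. F v i * p v k))"
      unfolding sum_distrib_left by (rule sum.swap)
    also have "\<dots> = (\<Sum>k<d. y k * (\<Sum>v\<in>insert x T. F v k * p v i))"
      by (rule sum.cong) (auto simp only: sym[OF i] lessThan_iff)
    also have "\<dots> = (\<Sum>v\<in>insert x T. \<Sum>k<d. y k * (F v k * p v i))"
      unfolding sum_distrib_left by (rule sum.swap)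
    also have "\<dots> = (\<Sum>v\<in>insert x T. \<beta> v * p v i)"
      by (simp only: \<beta>_def sum_distrib_right mult.assoc)
    finally have "F x i = (\<Sum>v\<in>insert x T. \<beta> v * p v i) - (\<Sum>v\<in>insert x T. \<beta> v) * p x i"
      by (simp only: total[OF i] \<beta>_total mult_zero_left mult_zero_right add_0_left diff_zero)
    also have "\<dots> = (\<Sum>v\<in>insert x T. \<beta> v * (p v i - p x i))"
      by (simp only: right_diff_distrib sum_subtractf sum_distrib_right)
    also have "\<dots> = - (\<Sum>v\<in>T. \<beta> v * (p x i - p v i))"
      using insert.hyps by (simp add: sum_negf[symmetric] algebra_simps)
    finally show ?thesis .
  qed
  have star: "{x, v} \<in> all_pairs (insert x T)" if "v \<in> T" for v
    using that insert.hyps(2) by (cases "x = v") (auto simp: all_pairs_def)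
  define F' where "F' w i = F w i + (\<Sum>v\<in>T. \<beta> v * edge_row p {x, v} w i)" for w i
  have load': "equilibrium_load d p (insert x T) F'"
    unfolding F'_def using star insert.hyps
    by (intro equilibrium_load_add[OF insert.prems(2)] equilibrium_load_sum equilibrium_load_edge_row) auto
  have at_x: "F' x i = 0" if "i < d" for i
  proof -
    have "(\<Sum>v\<in>T. \<beta> v * edge_row p {x, v} x i) = (\<Sum>v\<in>T. \<beta> v * (p x i - p v i))"
    proof (rule sum.cong)
      fix v assume "v \<in> T"
      then have "x \<noteq> v" using insert.hyps(2) by blast
      then show "\<beta> v * edge_row p {x, v} x i = \<beta> v * (p x i - p v i)"
        by (simp add: edge_row_pair)
    qed simp
    then show ?thesis using force[OF that] by (simp add: F'_def)
  qed
  have "equilibrium_load d p T F'"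
    using load' at_x insert.hyps by (simp add: equilibrium_load_def)
  moreover have "affinely_independent d T p"
    using affinely_independent_subset[OF insert.prems(1)] insert.hyps(1) by blast
  ultimately obtain \<kappa> where \<kappa>: "\<And>w i. w \<in> T \<Longrightarrow> i < d \<Longrightarrow>
      F' w i = (\<Sum>e\<in>all_pairs T. \<kappa> e * edge_row p e w i)"
    using insert.IH by blast
  define \<kappa>' where
    "\<kappa>' e = (if x \<in> e then - \<beta> (THE v. v \<in> e - {x}) else \<kappa> e)" for e
  have \<kappa>'_star: "\<kappa>' {x, v} = - \<beta> v" if "v \<in> T" for v
  proof -
    have "{x, v} - {x} = {v}" using that insert.hyps by auto
    then show ?thesis by (simp add: \<kappa>'_def)
  qed
  have no_x: "x \<notin> e" if "e \<in> all_pairs T" for e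
    using that insert.hyps by (auto simp: all_pairs_def)
  have "F w i = (\<Sum>e\<in>all_pairs (insert x T). \<kappa>' e * edge_row p e w i)"
    if w: "w \<in> insert x T" and i: "i < d" for w i
  proof -
    have "(\<Sum>e\<in>all_pairs (insert x T). \<kappa>' e * edge_row p e w i)
        = (\<Sum>e\<in>all_pairs T. \<kappa>' e * edge_row p e w i)
          + (\<Sum>e\<in>(\<lambda>v. {x, v}) ` T. \<kappa>' e * edge_row p e w i)"
      unfolding all_pairs_insert using insert.hyps no_x finite_all_pairs[of T]
      by (subst sum.union_disjoint) auto
    also have "(\<Sum>e\<in>all_pairs T. \<kappa>' e * edge_row p e w i) = (\<Sum>e\<in>all_pairs T. \<kappa> e * edge_row p e w i)"
      by (rule sum.cong) (auto simp: \<kappa>'_def dest: no_x)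
    also have "\<dots> = F' w i"
    proof (cases "w = x")
      case True
      then show ?thesis using at_x i no_x by (simp add: edge_row_def sum.neutral)
    qed (use w i \<kappa> in auto)
    also have "(\<Sum>e\<in>(\<lambda>v. {x, v}) ` T. \<kappa>' e * edge_row p e w i)
        = (\<Sum>v\<in>T. - \<beta> v * edge_row p {x, v} w i)"
      by (subst sum.reindex) (auto simp: inj_on_def doubleton_eq_iff \<kappa>'_star intro!: sum.cong)
    finally show ?thesis by (simp add: F'_def sum_negf)
  qed
  then show ?case by blast
qed

section \<open>Gluing stresses; minimal dependent sets\<close>

lemma stressI_support:
  assumes "stress d p E \<omega>" "finite E" "finite E'" "\<And>e. \<omega> e \<noteq> 0 \<Longrightarrow> e \<in> E'"
  shows "stress d p E' \<omega>"
proof -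
  have "(\<Sum>e\<in>E'. \<omega> e * edge_row p e w i) = (\<Sum>e\<in>E. \<omega> e * edge_row p e w i)" for w i
  proof -
    have "(\<Sum>e\<in>E'. \<omega> e * edge_row p e w i) = (\<Sum>e\<in>E \<inter> E'. \<omega> e * edge_row p e w i)"
      using assms by (intro sum.mono_neutral_right) (auto simp: stress_def)
    also have "\<dots> = (\<Sum>e\<in>E. \<omega> e * edge_row p e w i)"
      using assms by (intro sum.mono_neutral_left) auto
    finally show ?thesis .
  qed
  then show ?thesis using assms unfolding stress_def by auto
qed

lemma stress_support: "stress d p E \<omega> \<Longrightarrow> \<omega> e \<noteq> 0 \<Longrightarrow> e \<in> E"
  by (auto simp: stress_def)

lemma stress_mono: "stress d p E \<omega> \<Longrightarrow> E \<subseteq> E' \<Longrightarrow> finite E' \<Longrightarrow> stress d p E' \<omega>"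
  by (rule stressI_support[of d p E]) (auto dest: stress_support intro: finite_subset)

lemma stress_free_subset: "stress_free d p E' \<Longrightarrow> E \<subseteq> E' \<Longrightarrow> finite E' \<Longrightarrow> stress_free d p E"
  unfolding stress_free_def using stress_mono by blast

lemma stress_lincomb:
  assumes "stress d p E \<omega>" "stress d p E \<tau>"
  shows "stress d p E (\<lambda>e. a * \<omega> e + b * \<tau> e)"
proof -
  have "(\<Sum>e\<in>E. (a * \<omega> e + b * \<tau> e) * edge_row p e w i)
      = a * (\<Sum>e\<in>E. \<omega> e * edge_row p e w i) + b * (\<Sum>e\<in>E. \<tau> e * edge_row p e w i)" for w i
    by (simp add: sum_distrib_left distrib_right sum.distrib mult.assoc)
  then show ?thesis using assms by (simp add: stress_def)
qed

lemma edge_row_cong: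
  assumes "e \<in> all_pairs V" "\<And>v. v \<in> V \<Longrightarrow> p v = q v"
  shows "edge_row p e w i = edge_row q e w i"
proof -
  obtain u v where "u \<noteq> v" "e = {u, v}" "u \<in> V" "v \<in> V" using assms(1) by (rule all_pairsE)
  then show ?thesis using assms(2) by (simp add: edge_row_pair)
qed

lemma stress_cong:
  assumes "E \<subseteq> all_pairs V" "\<And>v. v \<in> V \<Longrightarrow> p v = q v" "stress d p E \<omega>"
  shows "stress d q E \<omega>"
proof -
  have "(\<Sum>e\<in>E. \<omega> e * edge_row q e w i) = (\<Sum>e\<in>E. \<omega> e * edge_row p e w i)" for w i
    using assms(1,2) edge_row_cong[of _ V p q] by (intro sum.cong) auto
  then show ?thesis using assms(3) by (simp add: stress_def)
qed

lemma affinely_independent_cong: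
  assumes "affinely_independent d T p" "\<And>v. v \<in> T \<Longrightarrow> p v = q v"
  shows "affinely_independent d T q"
proof -
  have "(\<Sum>v\<in>T. c v * q v i) = (\<Sum>v\<in>T. c v * p v i)" for c i
    using assms(2) by (intro sum.cong) auto
  then show ?thesis using assms(1) by (simp add: affinely_independent_def)
qed

text \<open>The forces that the part of \<open>\<tau>\<close> on \<open>E1\<close> exerts are in equilibrium, as those of every single edge are. They vanish
outside \<open>V2\<close> too, because they are cancelled by the edges of \<open>E2\<close>. Hence they form an equilibrium load on
\<open>V1 \<inter> V2\<close>, which the complete graph there resolves. Moving that resolution from one side to the other
splits \<open>\<tau>\<close>.\<close>

lemma stress_split:
  assumes V: "finite V1" "finite V2"
    and E: "E1 \<subseteq> all_pairs V1" "E2 \<subseteq> all_pairs V2" "all_pairs (V1 \<inter> V2) \<subseteq> E1 \<inter> E2"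
    and indep: "affinely_independent d (V1 \<inter> V2) p"
    and \<tau>: "stress d p (E1 \<union> E2) \<tau>"
  obtains \<tau>1 \<tau>2 where "stress d p E1 \<tau>1" "stress d p E2 \<tau>2" "\<And>e. \<tau> e = \<tau>1 e + \<tau>2 e"
proof -
  let ?T = "V1 \<inter> V2" and ?K = "all_pairs (V1 \<inter> V2)"
  have fin: "finite E1" "finite E2" "finite ?K"
    using V E(1,2) finite_all_pairs finite_subset by (blast, blast, simp add: finite_all_pairs)
  define F where "F w i = (\<Sum>e\<in>E1. \<tau> e * edge_row p e w i)" for w i
  have outside: "F w i = 0" if w: "w \<notin> ?T" and i: "i < d" for w i
  proof (cases "w \<in> V1")
    case False
    then show ?thesis
      using E(1) unfolding F_def by (intro sum.neutral) (auto simp: edge_row_outside[of _ V1])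
  next
    case True
    have "(\<Sum>e\<in>E1 \<union> E2. \<tau> e * edge_row p e w i) = F w i + (\<Sum>e\<in>E2 - E1. \<tau> e * edge_row p e w i)"
      unfolding F_def using fin by (subst sum.union_disjoint[symmetric]) (auto intro!: sum.cong)
    moreover have "(\<Sum>e\<in>E2 - E1. \<tau> e * edge_row p e w i) = 0"
      using E(2) w True by (intro sum.neutral) (auto simp: edge_row_outside[of _ V2])
    ultimately show ?thesis using \<tau> i by (simp add: stress_def)
  qed
  have "equilibrium_load d p V1 F"
    unfolding F_def using E(1) V(1) by (intro equilibrium_load_sum equilibrium_load_edge_row) auto
  moreover have "(\<Sum>w\<in>V1. F w i * g w) = (\<Sum>w\<in>?T. F w i * g w)" if "i < d" for i g
    using V(1) outside that by (intro sum.mono_neutral_right) auto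
  note restr = this this[of _ "\<lambda>_. 1", simplified]
  ultimately have "equilibrium_load d p ?T F"
    unfolding equilibrium_load_def by (simp add: restr)
  then obtain \<kappa> where \<kappa>: "\<And>w i. w \<in> ?T \<Longrightarrow> i < d \<Longrightarrow> F w i = (\<Sum>e\<in>?K. \<kappa> e * edge_row p e w i)"
    using load_resolved_by_complete_graph[OF _ indep] V by blast
  define \<tau>1 where "\<tau>1 e = (if e \<in> E1 then \<tau> e - (if e \<in> ?K then \<kappa> e else 0) else 0)" for e
  define \<tau>2 where "\<tau>2 e = 1 * \<tau> e + (-1) * \<tau>1 e" for e
  have \<tau>1: "stress d p E1 \<tau>1"
    unfolding stress_def
  proof (intro conjI allI impI)
    fix w i assume i: "i < d"
    have "(\<Sum>e\<in>E1. \<tau>1 e * edge_row p e w i)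
        = (\<Sum>e\<in>E1. \<tau> e * edge_row p e w i - (if e \<in> ?K then \<kappa> e * edge_row p e w i else 0))"
      by (rule sum.cong) (auto simp: \<tau>1_def algebra_simps)
    also have "\<dots> = F w i - (\<Sum>e\<in>E1 \<inter> ?K. \<kappa> e * edge_row p e w i)"
      using fin by (simp add: sum_subtractf F_def sum.inter_restrict)
    also have "E1 \<inter> ?K = ?K" using E(3) by blast
    also have "F w i - (\<Sum>e\<in>?K. \<kappa> e * edge_row p e w i) = 0"
    proof (cases "w \<in> ?T")
      case False
      then have "(\<Sum>e\<in>?K. \<kappa> e * edge_row p e w i) = 0"
        by (intro sum.neutral) (simp add: edge_row_outside[of _ ?T])
      then show ?thesis using outside[OF False i] by simp
    qed (simp add: \<kappa> i)
    finally show "(\<Sum>e\<in>E1. \<tau>1 e * edge_row p e w i) = 0" .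
  qed (simp add: \<tau>1_def)
  have "stress d p (E1 \<union> E2) \<tau>2"
    unfolding \<tau>2_def using fin by (intro stress_lincomb \<tau> stress_mono[OF \<tau>1]) auto
  then have "stress d p E2 \<tau>2"
  proof (rule stressI_support)
    fix e assume e: "\<tau>2 e \<noteq> 0"
    show "e \<in> E2"
    proof (rule ccontr)
      assume "e \<notin> E2"
      then have "e \<notin> ?K" "e \<notin> E1 \<Longrightarrow> \<tau> e = 0" using E(3) stress_support[OF \<tau>] by blast+
      then show False using e by (auto simp: \<tau>2_def \<tau>1_def split: if_splits)
    qed
  qed (use fin in auto)
  then show thesis by (rule that[OF \<tau>1]) (simp add: \<tau>2_def)
qed

text \<open>Pairing the equilibrium of the forces at \<open>u\<close> with an affine function that is \<open>1\<close> at \<open>v\<close> and \<open>0\<close> at all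
other points leaves only the term of the edge \<open>{u, v}\<close>.\<close>

lemma complete_graph_stress_free:
  assumes T: "finite T" and indep: "affinely_independent d T p"
  shows "stress_free d p (all_pairs T)"
  unfolding stress_free_def
proof (intro allI impI, rule ccontr)
  fix \<omega> e assume \<omega>: "stress d p (all_pairs T) \<omega>" "\<omega> e \<noteq> 0"
  then have e: "e \<in> all_pairs T" by (auto dest: stress_support)
  then obtain u v where uv: "u \<noteq> v" "e = {u, v}" "u \<in> T" "v \<in> T" by (rule all_pairsE)
  obtain a0 y where a: "\<And>w. w \<in> T \<Longrightarrow> a0 + (\<Sum>k<d. y k * p w k) = of_bool (w = v)"
    using dual_affine_function[OF indep T uv(4)] by blast
  have row: "(\<Sum>k<d. y k * edge_row p f u k) = (if f = e then -1 else 0)" if "f \<in> all_pairs T" for f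
  proof (cases "u \<in> f")
    case True
    obtain w where w: "w \<noteq> u" "f = {u, w}" "w \<in> T"
      using \<open>f \<in> all_pairs T\<close> True by (rule other_endpoint)
    have "(\<Sum>k<d. y k * edge_row p f u k) = (\<Sum>k<d. y k * p u k) - (\<Sum>k<d. y k * p w k)"
      using w by (simp add: edge_row_pair right_diff_distrib sum_subtractf)
    also have "\<dots> = of_bool (u = v) - of_bool (w = v)"
      using a[OF uv(3)] a[OF w(3)] by (metis add_diff_cancel_left)
    finally show ?thesis using uv w by (auto simp: doubleton_eq_iff)
  next
    case False
    then show ?thesis using uv by (auto simp: edge_row_def)
  qed
  have "0 = (\<Sum>k<d. y k * (\<Sum>f\<in>all_pairs T. \<omega> f * edge_row p f u k))"
    using \<omega>(1) by (simp add: stress_def)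
  also have "\<dots> = (\<Sum>k<d. \<Sum>f\<in>all_pairs T. \<omega> f * (y k * edge_row p f u k))"
    by (simp add: sum_distrib_left mult.left_commute)
  also have "\<dots> = (\<Sum>f\<in>all_pairs T. \<Sum>k<d. \<omega> f * (y k * edge_row p f u k))"
    by (rule sum.swap)
  also have "\<dots> = (\<Sum>f\<in>all_pairs T. if f = e then - \<omega> e else 0)"
    by (rule sum.cong) (simp_all add: sum_distrib_left[symmetric] row)
  also have "\<dots> = - \<omega> e" using e finite_all_pairs[OF T] by simp
  finally show False using \<omega>(2) by simp
qed

lemma affinely_independent_distinct:
  assumes "affinely_independent d T p" "finite T" "u \<noteq> v" "u \<in> T" "v \<in> T"
  obtains i where "i < d" "p u i \<noteq> p v i"
proof -
  obtain a0 y where a: "\<And>w. w \<in> T \<Longrightarrow> a0 + (\<Sum>k<d. y k * p w k) = of_bool (w = v)"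
    using dual_affine_function[OF assms(1,2,5)] by blast
  have "\<exists>i<d. p u i \<noteq> p v i"
  proof (rule ccontr)
    assume "\<not> ?thesis"
    then have "(\<Sum>k<d. y k * p u k) = (\<Sum>k<d. y k * p v k)" by (intro sum.cong) auto
    then show False using a[OF assms(4)] a[OF assms(5)] assms(3) by simp
  qed
  then show thesis using that by blast
qed

text \<open>A single nonzero force at \<open>u\<close> cannot be balanced.\<close>

lemma stress_another_edge:
  assumes \<omega>: "stress d p E \<omega>" "\<omega> {u, v} \<noteq> 0" and "finite E" "u \<noteq> v" "i < d" "p u i \<noteq> p v i"
  shows "\<exists>f. f \<noteq> {u, v} \<and> \<omega> f \<noteq> 0 \<and> u \<in> f"
proof (rule ccontr)
  assume none: "\<not> ?thesis"
  have "0 = (\<Sum>f\<in>E. \<omega> f * edge_row p f u i)" using \<omega>(1) \<open>i < d\<close> by (simp add: stress_def)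
  also have "\<dots> = (\<Sum>f\<in>E. if f = {u, v} then \<omega> {u, v} * (p u i - p v i) else 0)"
    using none \<open>u \<noteq> v\<close> by (intro sum.cong) (auto simp: edge_row_pair, auto simp: edge_row_def)
  also have "\<dots> = \<omega> {u, v} * (p u i - p v i)"
    using \<open>finite E\<close> stress_support[OF \<omega>] by simp
  finally show False using \<omega>(2) assms(6) by simp
qed

definition min_dependent :: "nat \<Rightarrow> ('a \<Rightarrow> nat \<Rightarrow> complex) \<Rightarrow> 'a set set \<Rightarrow> bool" where
  "min_dependent d p C \<longleftrightarrow> \<not> stress_free d p C \<and> (\<forall>F. F \<subset> C \<longrightarrow> stress_free d p F)"

lemma min_dependentE:
  assumes "min_dependent d p C"
  obtains \<omega> f where "stress d p C \<omega>" "\<omega> f \<noteq> 0"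
  using assms by (auto simp: min_dependent_def stress_free_def)

lemma min_dependent_exists:
  assumes "finite E" "\<not> stress_free d p E"
  shows "\<exists>C\<subseteq>E. min_dependent d p C"
  using assms
proof (induction E rule: finite_psubset_induct)
  case (psubset E)
  show ?case
  proof (cases "\<exists>F. F \<subset> E \<and> \<not> stress_free d p F")
    case True
    then show ?thesis using psubset.IH by (meson order.trans psubset_imp_subset)
  next
    case False
    then show ?thesis using psubset.prems by (auto simp: min_dependent_def)
  qed
qed

lemma min_dependent_stress_support:
  assumes C: "min_dependent d p C" "finite C" and \<omega>: "stress d p C \<omega>" "\<omega> f \<noteq> 0"
  shows "{e. \<omega> e \<noteq> 0} = C"
proof
  show "{e. \<omega> e \<noteq> 0} \<subseteq> C" using stress_support[OF \<omega>(1)] by blast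
  have "stress d p {e. \<omega> e \<noteq> 0} \<omega>"
    using \<omega>(1) C(2) finite_subset[OF \<open>{e. \<omega> e \<noteq> 0} \<subseteq> C\<close> C(2)]
    by (rule stressI_support) simp
  then have "\<not> stress_free d p {e. \<omega> e \<noteq> 0}"
    using \<omega>(2) by (auto simp: stress_free_def)
  then show "C \<subseteq> {e. \<omega> e \<noteq> 0}"
    using C(1) \<open>{e. \<omega> e \<noteq> 0} \<subseteq> C\<close> unfolding min_dependent_def by blast
qed

lemma stress_determined:
  assumes free: "stress_free d p (E - {e})" and "finite E"
    and \<omega>: "stress d p E \<omega>" "\<omega> e = 1" and \<tau>: "stress d p E \<tau>"
  shows "\<tau> f = \<tau> e * \<omega> f"
proof -
  let ?\<sigma> = "\<lambda>f. 1 * \<tau> f + (- \<tau> e) * \<omega> f"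
  have \<sigma>: "stress d p E ?\<sigma>" using \<tau> \<omega>(1) by (rule stress_lincomb)
  have "stress d p (E - {e}) ?\<sigma>"
  proof (rule stressI_support[OF \<sigma>])
    fix f assume "?\<sigma> f \<noteq> 0"
    then show "f \<in> E - {e}" using stress_support[OF \<sigma>, of f] \<omega>(2) by auto
  qed (use \<open>finite E\<close> in auto)
  then have "?\<sigma> f = 0" using free unfolding stress_free_def by blast
  then show ?thesis by simp
qed

text \<open>Both sides say that the stresses of \<open>E\<close> are the multiples of one stress, which is nonzero at \<open>e\<close> and has
support \<open>C\<close>. From left to right, a dependent subset of \<open>E - {e}\<close> would contain a second
minimal dependent set; from right to left, a stress is determined by its value at \<open>e\<close>.\<close>

lemma unique_min_dependent_iff:
  assumes "finite E"
  shows "e \<in> C \<and> C \<subseteq> E \<and> min_dependent d p C \<and> (\<forall>F\<subseteq>E. min_dependent d p F \<longrightarrow> F = C) \<longleftrightarrow>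
    stress_free d p (E - {e}) \<and> (\<exists>\<omega>. stress d p E \<omega> \<and> \<omega> e = 1 \<and> C = {f. \<omega> f \<noteq> 0})"
    (is "?unique \<longleftrightarrow> ?stress")
proof
  assume C: ?unique
  have free: "stress_free d p (E - {e})"
  proof (rule ccontr)
    assume "\<not> ?thesis"
    then obtain F where "F \<subseteq> E - {e}" "min_dependent d p F"
      using min_dependent_exists[of "E - {e}" d p] assms by auto
    then show False using C by blast
  qed
  have fC: "finite C" using C assms finite_subset by blast
  obtain \<omega> f where \<omega>: "stress d p C \<omega>" "\<omega> f \<noteq> 0"
    using C min_dependentE by metis
  have supp: "{f. \<omega> f \<noteq> 0} = C" using min_dependent_stress_support[OF _ fC \<omega>] C by blast
  then have "\<omega> e \<noteq> 0" using C by blast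
  have "stress d p E (\<lambda>f. (1 / \<omega> e) * \<omega> f + 0 * \<omega> f)"
    using stress_mono[OF \<omega>(1)] C assms by (intro stress_lincomb) auto
  then show ?stress
    using free supp \<open>\<omega> e \<noteq> 0\<close> by (intro conjI exI[of _ "\<lambda>f. (1 / \<omega> e) * \<omega> f + 0 * \<omega> f"]) auto
next
  assume ?stress
  then obtain \<omega> where free: "stress_free d p (E - {e})" and \<omega>: "stress d p E \<omega>" "\<omega> e = 1"
    and C: "C = {f. \<omega> f \<noteq> 0}" by blast
  have CE: "C \<subseteq> E" using stress_support[OF \<omega>(1)] C by blast
  then have fC: "finite C" using assms finite_subset by blast
  have supp: "{f. \<tau> f \<noteq> 0} = C" if "stress d p F \<tau>" "F \<subseteq> E" "\<tau> g \<noteq> 0" for F \<tau> g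
  proof -
    have det: "\<tau> f = \<tau> e * \<omega> f" for f
      using stress_determined[OF free assms \<omega> stress_mono[OF that(1,2) assms]] .
    have "\<tau> e \<noteq> 0" using that(3) det[of g] by (metis mult_zero_left)
    then have "\<tau> f \<noteq> 0 \<longleftrightarrow> \<omega> f \<noteq> 0" for f by (metis det mult_eq_0_iff)
    then show ?thesis unfolding C by blast
  qed
  have "stress d p C \<omega>"
    using \<omega>(1) assms fC by (rule stressI_support) (simp add: C)
  then have "\<not> stress_free d p C" using \<omega>(2) unfolding stress_free_def by force
  moreover have "stress_free d p F" if F: "F \<subset> C" for F
  proof (rule ccontr)
    assume "\<not> ?thesis"
    then obtain \<tau> g where \<tau>: "stress d p F \<tau>" "\<tau> g \<noteq> 0"
      unfolding stress_free_def by blast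
    then have "C \<subseteq> F" using supp[of F \<tau> g] F CE stress_support[OF \<tau>(1)] by blast
    then show False using F by blast
  qed
  moreover have "F = C" if F: "F \<subseteq> E" "min_dependent d p F" for F
  proof -
    obtain \<tau> g where \<tau>: "stress d p F \<tau>" "\<tau> g \<noteq> 0"
      using F(2) by (rule min_dependentE)
    show ?thesis
      using min_dependent_stress_support[OF F(2) finite_subset[OF F(1) assms] \<tau>]
        supp[OF \<tau>(1) F(1) \<tau>(2)] by simp
  qed
  moreover have "e \<in> C" using \<omega>(2) C by simp
  ultimately show ?unique using CE unfolding min_dependent_def by blast
qed

section \<open>Projective transformations\<close>

text \<open>In homogeneous coordinates, \<open>q\<close> is the image of \<open>p\<close> under the linear map that adds \<open>s * a\<close> times the point
\<open>p x\<close>, where the linear form \<open>a\<close> is \<open>1\<close> at \<open>p x\<close>; the factor \<open>\<mu> j\<close> normalizes the last coordinate. Dividing by \<open>\<mu> i * \<mu> j\<close> turns stresses at \<open>q\<close> into stresses at \<open>p\<close>.\<close>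

lemma stress_projective_image:
  fixes d :: nat and p :: "'a \<Rightarrow> nat \<Rightarrow> complex" and y :: "nat \<Rightarrow> complex" and a0 s :: complex and x :: 'a
  defines "a \<equiv> \<lambda>j. a0 + (\<Sum>k<d. y k * p j k)"
  defines "\<mu> \<equiv> \<lambda>j. 1 + s * a j"
  assumes E: "E \<subseteq> all_pairs V" and x: "x \<in> V" "a x = 1"
    and \<mu>: "\<And>j. j \<in> V \<Longrightarrow> \<mu> j \<noteq> 0"
    and q: "\<And>j i. j \<in> V \<Longrightarrow> i < d \<Longrightarrow> q j i = (p j i + s * a j * p x i) / \<mu> j"
    and \<tau>: "stress d q E \<tau>"
  shows "stress d p E (\<lambda>e. \<tau> e / (\<Prod>j\<in>e. \<mu> j))"
proof -
  define \<omega> where "\<omega> e = \<tau> e / (\<Prod>j\<in>e. \<mu> j)" for e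
  \<comment> \<open>\<open>W w\<close> is the resultant force at \<open>w\<close> in \<open>p\<close>, and \<open>A e w\<close> is the increment of \<open>a\<close> along the edge \<open>e\<close>.\<close>
  define W where "W w i = (\<Sum>e\<in>E. \<omega> e * edge_row p e w i)" for w i
  define A where "A e w = (\<Sum>k<d. y k * edge_row p e w k)" for e w
  have row: "\<tau> e * edge_row q e w i = \<omega> e * edge_row p e w i * \<mu> w + s * (\<omega> e * A e w) * (p x i - p w i)"
    if e: "e \<in> E" and i: "i < d" for e w i
  proof (cases "w \<in> e")
    case False
    then show ?thesis by (simp add: edge_row_def A_def)
  next
    case True
    have "e \<in> all_pairs V" using e E by blast
    then obtain z where z: "z \<noteq> w" "e = {w, z}" "w \<in> V" "z \<in> V"
      using True by (rule other_endpoint)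
    have A: "A e w = a w - a z"
      using z by (simp add: A_def a_def edge_row_pair right_diff_distrib sum_subtractf)
    have "\<tau> e = \<omega> e * (\<mu> w * \<mu> z)"
      using z \<mu> by (simp add: \<omega>_def)
    then have "\<tau> e * edge_row q e w i = \<omega> e * ((\<mu> w * \<mu> z) * edge_row q e w i)"
      by simp
    also have "(\<mu> w * \<mu> z) * edge_row q e w i
        = (p w i + s * a w * p x i) * \<mu> z - (p z i + s * a z * p x i) * \<mu> w"
      using z i \<mu>[of w] \<mu>[of z] by (simp add: edge_row_pair q field_simps)
    also have "\<dots> = edge_row p e w i * \<mu> w + s * A e w * (p x i - p w i)"
      unfolding A using z by (simp add: edge_row_pair \<mu>_def algebra_simps)
    finally show ?thesis by (simp only: distrib_left mult.assoc mult.left_commute)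
  qed
  have AW: "(\<Sum>e\<in>E. \<omega> e * A e w) = (\<Sum>k<d. y k * W w k)" for w
  proof -
    have "(\<Sum>e\<in>E. \<omega> e * A e w) = (\<Sum>e\<in>E. \<Sum>k<d. y k * (\<omega> e * edge_row p e w k))"
      by (simp add: A_def sum_distrib_left mult.left_commute)
    also have "\<dots> = (\<Sum>k<d. \<Sum>e\<in>E. y k * (\<omega> e * edge_row p e w k))" by (rule sum.swap)
    finally show ?thesis by (simp add: W_def sum_distrib_left)
  qed
  have balance: "W w i * \<mu> w + s * (\<Sum>k<d. y k * W w k) * (p x i - p w i) = 0" if "i < d" for w i
  proof -
    have "0 = (\<Sum>e\<in>E. \<tau> e * edge_row q e w i)" using \<tau> that by (simp add: stress_def)
    also have "\<dots> = (\<Sum>e\<in>E. \<omega> e * edge_row p e w i * \<mu> w + s * (\<omega> e * A e w) * (p x i - p w i))"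
      by (rule sum.cong) (simp_all add: row that)
    also have "\<dots> = W w i * \<mu> w + s * (\<Sum>k<d. y k * W w k) * (p x i - p w i)"
      by (simp add: AW[symmetric] sum.distrib sum_distrib_left sum_distrib_right)
        (simp add: W_def sum_distrib_right)
    finally show ?thesis by simp
  qed
  have "W w i = 0" if i: "i < d" for w i
  proof (cases "w \<in> V")
    case False
    then show ?thesis
      using E unfolding W_def by (intro sum.neutral) (auto simp: edge_row_outside[of _ V])
  next
    case True
    \<comment> \<open>Applying the linear part of \<open>a\<close> to the balance of forces at \<open>w\<close> in \<open>q\<close> shows that it annihilates
      the resultant; what is left of the balance is then \<open>\<mu> w * W w = 0\<close>.\<close>
    define \<alpha> where "\<alpha> = (\<Sum>k<d. y k * W w k)"
    have "0 = (\<Sum>k<d. y k * (W w k * \<mu> w + s * \<alpha> * (p x k - p w k)))"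
      using balance by (simp add: \<alpha>_def)
    also have "\<dots> = (\<Sum>k<d. y k * W w k * \<mu> w + (s * \<alpha> * (y k * p x k) - s * \<alpha> * (y k * p w k)))"
      by (rule sum.cong) (simp_all add: algebra_simps)
    also have "\<dots> = (\<Sum>k<d. y k * W w k) * \<mu> w
        + s * \<alpha> * ((\<Sum>k<d. y k * p x k) - (\<Sum>k<d. y k * p w k))"
      by (simp only: sum.distrib sum_subtractf sum_distrib_left sum_distrib_right right_diff_distrib)
    also have "(\<Sum>k<d. y k * W w k) = \<alpha>" by (simp only: \<alpha>_def)
    also have "(\<Sum>k<d. y k * p x k) - (\<Sum>k<d. y k * p w k) = 1 - a w"
      using x(2) by (auto simp: a_def eq_diff_eq add.commute)
    also have "\<alpha> * \<mu> w + s * \<alpha> * (1 - a w) = \<alpha> * \<mu> x"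
      using x(2) by (simp add: \<mu>_def algebra_simps)
    finally have "\<alpha> = 0" using \<mu>[OF x(1)] by simp
    then show ?thesis
      using balance[OF i, of w] \<mu>[OF True] by (simp add: \<alpha>_def)
  qed
  then show ?thesis
    using \<tau> unfolding stress_def W_def \<omega>_def by simp
qed

text \<open>The independence is proved at a point \<open>q\<close> that agrees with \<open>p\<close> on \<open>V2\<close> and is a projective image of \<open>p\<close> on
\<open>V1\<close>. There a stress is the sum of \<open>c * \<rho> * \<omega>1\<close> and a multiple of \<open>\<omega>2\<close>, where \<open>\<rho> h\<close> is the product of the scaling factors
of the ends of \<open>h\<close>. Vanishing at \<open>e\<close> and at \<open>f\<close> gives \<open>c * (\<rho> f * \<omega>1 f - \<rho> e * \<omega>2 f) = 0\<close>. The transformation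
is built around an endpoint \<open>x\<close> of \<open>e\<close> outside \<open>f\<close>, so that \<open>\<rho> e = 1 + s\<close> depends on the parameter \<open>s\<close> whereas
\<open>\<rho> f = 1\<close> if \<open>f\<close> joins two common vertices. Hence \<open>c = 0\<close> for all but one value of \<open>s\<close>.\<close>

lemma stress_free_union_minus_two_edges:
  assumes V: "finite V1" "finite V2"
    and E: "E1 \<subseteq> all_pairs V1" "E2 \<subseteq> all_pairs V2" "E1 \<inter> E2 = all_pairs (V1 \<inter> V2)"
    and e: "e \<in> E1 \<inter> E2"
    and p: "generic d (V1 \<union> V2) p" and indep: "affinely_independent d (V1 \<inter> V2) p"
    and free: "stress_free d p (E1 - {e})" "stress_free d p (E2 - {e})"
    and \<omega>1: "stress d p E1 \<omega>1" "\<omega>1 e = 1" and \<omega>2: "stress d p E2 \<omega>2" "\<omega>2 e = 1"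
    and f: "f \<in> E1 \<union> E2" "f \<noteq> e" "\<omega>1 f \<noteq> 0 \<or> \<omega>2 f \<noteq> 0"
  shows "stress_free d p (E1 \<union> E2 - {e, f})"
proof -
  let ?T = "V1 \<inter> V2"
  have fin: "finite E1" "finite E2"
    using V E(1,2) finite_all_pairs finite_subset by blast+
  have pairs: "E1 \<union> E2 \<subseteq> all_pairs (V1 \<union> V2)"
    using E(1,2) by (auto simp: all_pairs_def)
  have eT: "e \<in> all_pairs ?T" using e E(3) by blast
  have "\<not> e \<subseteq> f"
  proof
    assume "e \<subseteq> f"
    moreover have "card e = 2" "card f = 2" using eT f(1) pairs by (auto simp: all_pairs_def)
    ultimately show False using f(2) card_subset_eq[of f e] by (metis card.infinite zero_neq_numeral)
  qed
  then obtain x where x: "x \<in> e" "x \<notin> f" by blast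
  obtain z where z: "z \<noteq> x" "e = {x, z}" "x \<in> ?T" "z \<in> ?T"
    using eT x(1) by (rule other_endpoint)
  obtain a0 y where dual: "\<And>v. v \<in> ?T \<Longrightarrow> a0 + (\<Sum>k<d. y k * p v k) = of_bool (v = x)"
    using dual_affine_function[OF indep _ z(3)] V by blast
  define a where "a j = a0 + (\<Sum>k<d. y k * p j k)" for j
  have aT: "a v = of_bool (v = x)" if "v \<in> ?T" for v using dual[OF that] by (simp add: a_def)
  \<comment> \<open>The first values of \<open>s\<close> to avoid send a point of \<open>V1\<close> to infinity; the last one makes the two
    stresses cancel at \<open>f\<close>.\<close>
  have "finite ((\<lambda>j. - 1 / a j) ` V1 \<union> {\<omega>1 f / \<omega>2 f - 1})" using V by simp
  then obtain s where s: "s \<notin> (\<lambda>j. - 1 / a j) ` V1 \<union> {\<omega>1 f / \<omega>2 f - 1}"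
    using ex_new_if_finite[OF infinite_UNIV_char_0] by blast
  define \<mu> where "\<mu> j = 1 + s * a j" for j
  have \<mu>: "\<mu> j \<noteq> 0" if "j \<in> V1" for j
  proof
    assume 0: "\<mu> j = 0"
    then have "a j \<noteq> 0" by (auto simp: \<mu>_def)
    then have "s = - 1 / a j"
      using 0 by (simp add: \<mu>_def field_simps) (metis add.commute eq_neg_iff_add_eq_0 mult.commute)
    then show False using s that by blast
  qed
  have \<mu>T: "\<mu> v = (if v = x then 1 + s else 1)" if "v \<in> ?T" for v
    using aT[OF that] by (simp add: \<mu>_def)
  define q where "q j = (if j \<in> V1 then (\<lambda>i. (p j i + s * a j * p x i) / \<mu> j) else p j)" for j
  have qT: "q v = p v" if v: "v \<in> ?T" for v
  proof (cases "v = x")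
    case True
    have "1 + s \<noteq> 0" using \<mu>[of x] \<mu>T[of x] z(3) by simp
    moreover have "p x i + s * p x i = p x i * (1 + s)" for i by (simp add: algebra_simps)
    ultimately show ?thesis using True v aT[OF v] \<mu>T[OF v] by (simp add: q_def)
  qed (use v aT[OF v] \<mu>T[OF v] in \<open>simp add: q_def\<close>)
  then have q2: "q v = p v" if "v \<in> V2" for v
    using that by (cases "v \<in> V1") (auto simp: q_def)
  have "stress_free d q (E1 \<union> E2 - {e, f})"
    unfolding stress_free_def
  proof (intro allI impI)
    fix \<tau> g assume \<tau>': "stress d q (E1 \<union> E2 - {e, f}) \<tau>"
    then have \<tau>: "stress d q (E1 \<union> E2) \<tau>"
      using fin by (intro stress_mono[OF \<tau>']) auto
    have \<tau>0: "\<tau> e = 0" "\<tau> f = 0" using \<tau>' by (auto simp: stress_def)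
    have "affinely_independent d ?T q"
      using affinely_independent_cong[OF indep] qT by simp
    then obtain \<tau>1 \<tau>2 where split: "stress d q E1 \<tau>1" "stress d q E2 \<tau>2" "\<And>e. \<tau> e = \<tau>1 e + \<tau>2 e"
      using stress_split[OF V E(1,2) _ _ \<tau>] E(3) by blast
    define \<rho> where "\<rho> h = (\<Prod>j\<in>h. \<mu> j)" for h
    have \<rho>0: "\<rho> h \<noteq> 0" if "h \<in> E1" for h
    proof -
      have "h \<subseteq> V1" using that E(1) by (auto simp: all_pairs_def)
      then show ?thesis
        using finite_subset[OF _ V(1)] \<mu> unfolding \<rho>_def by (auto simp: prod_zero_iff)
    qed
    have \<rho>e: "\<rho> e = 1 + s" using z \<mu>T by (simp add: \<rho>_def)
    have "stress d p E1 (\<lambda>h. \<tau>1 h / \<rho> h)"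
      unfolding \<rho>_def \<mu>_def a_def
      by (rule stress_projective_image[where x=x and V=V1, OF E(1) _ _ _ _ split(1)])
        (use z(3) aT \<mu> in \<open>auto simp: q_def \<mu>_def a_def\<close>)
    then have \<tau>1: "\<tau>1 h = (\<tau>1 e / \<rho> e) * \<omega>1 h * \<rho> h" for h
      using stress_determined[OF free(1) fin(1) \<omega>1, of "\<lambda>h. \<tau>1 h / \<rho> h" h]
        \<rho>0[of h] split(1) \<omega>1(1) by (cases "h \<in> E1") (auto simp: stress_def field_simps)
    have "stress d p E2 \<tau>2" by (rule stress_cong[OF E(2) q2 split(2)])
    then have \<tau>2: "\<tau>2 h = \<tau>2 e * \<omega>2 h" for h
      by (rule stress_determined[OF free(2) fin(2) \<omega>2])
    define c where "c = \<tau>1 e / \<rho> e"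
    have at_e: "\<tau>2 e = - (c * (1 + s))"
      using \<tau>0(1) split(3)[of e] \<tau>1[of e] \<omega>1(2) \<rho>e by (simp add: c_def eq_neg_iff_add_eq_0 add.commute)
    have at_f: "c * (\<omega>1 f * \<rho> f - (1 + s) * \<omega>2 f) = 0"
      using \<tau>0(2) split(3)[of f] \<tau>1[of f] \<tau>2[of f] at_e by (simp add: c_def algebra_simps)
    have s1: "1 + s \<noteq> 0" using \<rho>0[of e] e \<rho>e by simp
    have "\<omega>1 f * \<rho> f - (1 + s) * \<omega>2 f \<noteq> 0"
    proof (cases "\<omega>1 f \<noteq> 0 \<and> \<omega>2 f \<noteq> 0")
      case True
      then have "f \<in> all_pairs ?T" using stress_support \<omega>1(1) \<omega>2(1) E(3) by blast
      then have "\<rho> f = 1"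
        unfolding \<rho>_def
      proof (intro prod.neutral ballI)
        fix j assume "j \<in> f"
        then have "j \<in> ?T" "j \<noteq> x"
          using \<open>f \<in> all_pairs ?T\<close> x(2) by (auto simp: all_pairs_def)
        then show "\<mu> j = 1" using \<mu>T[of j] by simp
      qed
      moreover have "s \<noteq> \<omega>1 f / \<omega>2 f - 1" using s by blast
      ultimately show ?thesis using True by (auto simp: field_simps)
    next
      case False
      then show ?thesis using f(3) s1 \<rho>0[of f] stress_support[OF \<omega>1(1), of f] by auto
    qed
    then have "c = 0" using at_f by simp
    then have "\<tau>1 g = 0" "\<tau>2 g = 0"
      using \<tau>1[of g, folded c_def] \<tau>2[of g] at_e by simp_all
    then show "\<tau> g = 0" using split(3) by simp
  qed
  then show ?thesis
    using pairs V by (intro stress_free_generic[OF p]) auto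
qed

section \<open>Circuits of t-sums\<close>

text \<open>A proper subgraph of a graph without isolated vertices misses an edge, so minimality
may be expressed by edge sets alone. The edgeless subgraphs, which do not count as graphs, are stress-free.\<close>

lemma rigidity_circuit_iff:
  assumes p: "generic d V p" and V: "finite V" "verts C \<subseteq> V"
  shows "rigidity_circuit d C \<longleftrightarrow>
    edges C \<subseteq> all_pairs (verts C) \<and> verts C = \<Union> (edges C) \<and> min_dependent d p (edges C)"
proof -
  have indep: "rigidity_independent d H \<longleftrightarrow> stress_free d p (edges H)"
    if "is_graph H" "verts H \<subseteq> V" for H
    using rigidity_independent_iff[OF generic_subset[OF p that(2)]] that(1)
    by (simp add: is_graph_def)
  have empty: "stress_free d p {}" by (simp add: stress_free_def stress_def)
  have cover: "no_isolated C \<longleftrightarrow> verts C = \<Union> (edges C)" if "is_graph C"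
    using that by (auto simp: no_isolated_def is_graph_def all_pairs_def)
  have proper: "(\<forall>H. is_graph H \<and> subgraph H C \<and> H \<noteq> C \<longrightarrow> rigidity_independent d H)
      \<longleftrightarrow> (\<forall>F. F \<subset> edges C \<longrightarrow> stress_free d p F)"
    if C: "is_graph C" "verts C = \<Union> (edges C)"
  proof (intro iffI allI impI)
    fix F assume sub: "\<forall>H. is_graph H \<and> subgraph H C \<and> H \<noteq> C \<longrightarrow> rigidity_independent d H"
      and F: "F \<subset> edges C"
    show "stress_free d p F"
    proof (cases "F = {}")
      case False
      let ?H = "Graph (verts C) F"
      have "?H \<noteq> C" using F by (metis graph.sel(2) psubset_eq)
      moreover have H: "is_graph ?H" "subgraph ?H C"
        using C(1) F False by (auto simp: is_graph_def subgraph_def)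
      ultimately show ?thesis using sub indep[of ?H] V(2) by simp
    qed (simp add: empty)
  next
    fix H assume free: "\<forall>F. F \<subset> edges C \<longrightarrow> stress_free d p F"
      and H: "is_graph H \<and> subgraph H C \<and> H \<noteq> C"
    have "edges H \<noteq> edges C"
    proof
      assume eq: "edges H = edges C"
      then have "verts C \<subseteq> verts H"
        using H C(2) by (auto simp: is_graph_def all_pairs_def)
      then show False using H eq by (auto simp: subgraph_def intro: graph.expand)
    qed
    then have "edges H \<subset> edges C" using H by (auto simp: subgraph_def)
    then show "rigidity_independent d H"
      using free indep[of H] H V(2) by (auto simp: subgraph_def)
  qed
  show ?thesis
  proof
    assume C: "rigidity_circuit d C"
    then have g: "is_graph C" by (simp add: rigidity_circuit_def)
    have un: "verts C = \<Union> (edges C)" using C cover[OF g] by (simp add: rigidity_circuit_def)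
    show "edges C \<subseteq> all_pairs (verts C) \<and> verts C = \<Union> (edges C) \<and> min_dependent d p (edges C)"
      using C g un proper[OF g un] indep[OF g V(2)]
      by (simp add: rigidity_circuit_def min_dependent_def is_graph_def)
  next
    assume C: "edges C \<subseteq> all_pairs (verts C) \<and> verts C = \<Union> (edges C) \<and> min_dependent d p (edges C)"
    then have un: "verts C = \<Union> (edges C)" by blast
    have "edges C \<noteq> {}" using C empty by (auto simp: min_dependent_def)
    then have g: "is_graph C" using C V finite_subset by (auto simp: is_graph_def)
    show "rigidity_circuit d C"
      using C g cover[OF g] proper[OF g un] indep[OF g V(2)]
      by (simp add: rigidity_circuit_def min_dependent_def)
  qed
qed

lemma unique_circuit_in_iff:
  assumes p: "generic d V p" and V: "finite V" "verts H \<subseteq> V" and H: "edges H \<subseteq> all_pairs (verts H)"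
  shows "unique_circuit_in d C H \<longleftrightarrow> verts C = \<Union> (edges C) \<and> edges C \<subseteq> edges H \<and>
    min_dependent d p (edges C) \<and> (\<forall>F\<subseteq>edges H. min_dependent d p F \<longrightarrow> F = edges C)"
    (is "_ \<longleftrightarrow> ?R")
proof -
  have circ: "rigidity_circuit d D \<and> subgraph D H \<longleftrightarrow>
      verts D = \<Union> (edges D) \<and> edges D \<subseteq> edges H \<and> min_dependent d p (edges D)" for D
  proof (cases "verts D \<subseteq> V")
    case True
    show ?thesis
      unfolding rigidity_circuit_iff[OF p V(1) True]
      using H by (fastforce simp: subgraph_def all_pairs_def)
  next
    case False
    then show ?thesis using H V(2) by (fastforce simp: subgraph_def all_pairs_def)
  qed
  show ?thesis
  proof
    assume C: "unique_circuit_in d C H"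
    have "F = edges C" if F: "F \<subseteq> edges H" "min_dependent d p F" for F
    proof -
      have "rigidity_circuit d (Graph (\<Union>F) F) \<and> subgraph (Graph (\<Union>F) F) H"
        using F by (simp add: circ)
      then have "Graph (\<Union>F) F = C" using C by (simp add: unique_circuit_in_def)
      then show ?thesis by auto
    qed
    then show ?R using C circ[of C] by (simp add: unique_circuit_in_def)
  next
    assume C: ?R
    have "D = C" if "rigidity_circuit d D \<and> subgraph D H" for D
    proof -
      have D: "verts D = \<Union> (edges D)" "edges D \<subseteq> edges H" "min_dependent d p (edges D)"
        using that circ[of D] by auto
      then have "edges D = edges C" using C by blast
      moreover have "verts C = \<Union> (edges C)" using C by (rule conjunct1)
      ultimately show ?thesis using D(1) by (simp add: graph.expand)
    qed
    moreover have "rigidity_circuit d C \<and> subgraph C H" using C circ[of C] by blast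
    ultimately show "unique_circuit_in d C H" unfolding unique_circuit_in_def by blast
  qed
qed

theorem theorem5p7:
  fixes d t :: nat and G G1 G2 :: "'a graph" and u v :: 'a
  assumes "d \<ge> 1"
    and "is_graph G" and "is_graph G1" and "is_graph G2"
    and "2 \<le> t" and "t \<le> d + 1"
    and "t_sum t G G1 G2 {u, v}"
    and "\<not> subgraph G1 G2" and "\<not> subgraph G2 G1"
  shows "rigidity_circuit d G \<longleftrightarrow>
    (\<exists>G1' G2'. unique_circuit_in d G1' G1 \<and> unique_circuit_in d G2' G2 \<and>
       {u, v} \<in> edges G1' \<inter> edges G2' \<and>
       add_edge G {u, v} = graph_union G1' G2')"
proof -
  let ?V1 = "verts G1" and ?V2 = "verts G2" and ?E1 = "edges G1" and ?E2 = "edges G2"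
  let ?V = "?V1 \<union> ?V2" and ?T = "?V1 \<inter> ?V2" and ?E = "?E1 \<union> ?E2 - {{u, v}}"
  have V: "finite ?V1" "finite ?V2" and E: "?E1 \<subseteq> all_pairs ?V1" "?E2 \<subseteq> all_pairs ?V2"
    using assms(3,4) by (auto simp: is_graph_def)
  have fin: "finite ?E1" "finite ?E2"
    using V E finite_all_pairs finite_subset by blast+
  have e: "{u, v} \<in> ?E1 \<inter> ?E2" and G: "G = Graph ?V ?E"
    and K: "?E1 \<inter> ?E2 = all_pairs ?T" and "card ?T = t"
    using assms(7) by (auto simp: t_sum_def graph_union_def graph_inter_def del_edge_def complete_on_def)
  have pairs: "?E \<subseteq> all_pairs ?V" using E by (auto simp: all_pairs_def)
  have eT: "{u, v} \<in> all_pairs ?T" using e K by blast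
  then have uv: "u \<noteq> v" "u \<in> ?T" "v \<in> ?T" by (auto simp: all_pairs_def)
  obtain p where p: "generic d ?V p" using generic_exists[of ?V d] V by auto
  have indep: "affinely_independent d ?T p"
    using V \<open>card ?T = t\<close> assms(6) by (intro generic_affinely_independent[OF p]) auto
  have circuit: "rigidity_circuit d G \<longleftrightarrow> ?V = \<Union>?E \<and> min_dependent d p ?E"
    using rigidity_circuit_iff[OF p, of G] V pairs by (simp add: G)
  have unique: "unique_circuit_in d C Gi \<and> {u, v} \<in> edges C \<longleftrightarrow> verts C = \<Union> (edges C) \<and>
      stress_free d p (edges Gi - {{u, v}}) \<and>
      (\<exists>\<omega>. stress d p (edges Gi) \<omega> \<and> \<omega> {u, v} = 1 \<and> edges C = {f. \<omega> f \<noteq> 0})"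
    if "Gi \<in> {G1, G2}" for C Gi
  proof -
    have Gi: "finite ?V" "verts Gi \<subseteq> ?V" "edges Gi \<subseteq> all_pairs (verts Gi)" "finite (edges Gi)"
      using that V E fin by auto
    show ?thesis
      unfolding unique_circuit_in_iff[OF p Gi(1-3)]
        unique_min_dependent_iff[OF Gi(4), of "{u, v}" "edges C" d p, symmetric]
      by (simp only: conj_ac)
  qed
  \<comment> \<open>The right-hand side of the theorem in terms of stresses: \<open>\<omega>1\<close> and \<open>\<omega>2\<close> are the stresses of the two
    circuits, normalized to be \<open>1\<close> at the edge \<open>{u, v}\<close>.\<close>
  define rhs where "rhs \<longleftrightarrow>
    stress_free d p (?E1 - {{u, v}}) \<and> stress_free d p (?E2 - {{u, v}}) \<and>
    (\<exists>\<omega>1 \<omega>2. stress d p ?E1 \<omega>1 \<and> \<omega>1 {u, v} = 1 \<and> stress d p ?E2 \<omega>2 \<and> \<omega>2 {u, v} = 1 \<and>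
       ?E1 \<union> ?E2 = {f. \<omega>1 f \<noteq> 0 \<or> \<omega>2 f \<noteq> 0} \<and> ?V = \<Union> (?E1 \<union> ?E2))"
  have "(\<exists>C1 C2. unique_circuit_in d C1 G1 \<and> unique_circuit_in d C2 G2 \<and>
       {u, v} \<in> edges C1 \<inter> edges C2 \<and> add_edge G {u, v} = graph_union C1 C2) \<longleftrightarrow> rhs"
    (is "?lhs \<longleftrightarrow> _")
  proof -
    have add: "add_edge G {u, v} = Graph ?V (?E1 \<union> ?E2)"
      using e by (auto simp: add_edge_def G)
    show ?thesis
    proof
      assume ?lhs
      then obtain C1 C2 where C: "unique_circuit_in d C1 G1 \<and> {u, v} \<in> edges C1"
        "unique_circuit_in d C2 G2 \<and> {u, v} \<in> edges C2" "add_edge G {u, v} = graph_union C1 C2"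
        by blast
      obtain \<omega>1 where 1: "verts C1 = \<Union> (edges C1)" "stress_free d p (?E1 - {{u, v}})"
        "stress d p ?E1 \<omega>1" "\<omega>1 {u, v} = 1" "edges C1 = {f. \<omega>1 f \<noteq> 0}"
        using C(1) unique[of G1 C1] by auto
      obtain \<omega>2 where 2: "verts C2 = \<Union> (edges C2)" "stress_free d p (?E2 - {{u, v}})"
        "stress d p ?E2 \<omega>2" "\<omega>2 {u, v} = 1" "edges C2 = {f. \<omega>2 f \<noteq> 0}"
        using C(2) unique[of G2 C2] by auto
      have un: "?V = verts C1 \<union> verts C2" "?E1 \<union> ?E2 = edges C1 \<union> edges C2"
        using C(3) unfolding add graph_union_def by auto
      have supp: "?E1 \<union> ?E2 = {f. \<omega>1 f \<noteq> 0 \<or> \<omega>2 f \<noteq> 0}"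
        unfolding un(2) 1(5) 2(5) by blast
      have cover: "?V = \<Union> (?E1 \<union> ?E2)"
        unfolding un 1(1) 2(1) by blast
      show rhs unfolding rhs_def
        by (intro conjI exI[of _ \<omega>1] exI[of _ \<omega>2] 1(2-4) 2(2-4) supp cover)
    next
      assume rhs
      then obtain \<omega>1 \<omega>2 where \<omega>: "stress_free d p (?E1 - {{u, v}})" "stress_free d p (?E2 - {{u, v}})"
        "stress d p ?E1 \<omega>1" "\<omega>1 {u, v} = 1" "stress d p ?E2 \<omega>2" "\<omega>2 {u, v} = 1"
        "?E1 \<union> ?E2 = {f. \<omega>1 f \<noteq> 0 \<or> \<omega>2 f \<noteq> 0}" "?V = \<Union> (?E1 \<union> ?E2)"
        unfolding rhs_def by blast
      define C1 where "C1 = Graph (\<Union> {f. \<omega>1 f \<noteq> 0}) {f. \<omega>1 f \<noteq> 0}"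
      define C2 where "C2 = Graph (\<Union> {f. \<omega>2 f \<noteq> 0}) {f. \<omega>2 f \<noteq> 0}"
      have "unique_circuit_in d C1 G1 \<and> {u, v} \<in> edges C1"
      proof (subst unique)
        show "verts C1 = \<Union> (edges C1) \<and> stress_free d p (?E1 - {{u, v}}) \<and>
            (\<exists>\<omega>. stress d p ?E1 \<omega> \<and> \<omega> {u, v} = 1 \<and> edges C1 = {f. \<omega> f \<noteq> 0})"
          using \<omega>(1,3,4) by (intro conjI exI[of _ \<omega>1]) (simp_all add: C1_def)
      qed simp
      moreover have "unique_circuit_in d C2 G2 \<and> {u, v} \<in> edges C2"
      proof (subst unique)
        show "verts C2 = \<Union> (edges C2) \<and> stress_free d p (?E2 - {{u, v}}) \<and>
            (\<exists>\<omega>. stress d p ?E2 \<omega> \<and> \<omega> {u, v} = 1 \<and> edges C2 = {f. \<omega> f \<noteq> 0})"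
          using \<omega>(2,5,6) by (intro conjI exI[of _ \<omega>2]) (simp_all add: C2_def)
      qed simp
      moreover have "add_edge G {u, v} = graph_union C1 C2"
        unfolding add graph_union_def C1_def C2_def \<omega>(8) \<omega>(7) by auto
      ultimately show ?lhs by blast
    qed
  qed
  moreover have "?V = \<Union>?E \<and> min_dependent d p ?E \<longleftrightarrow> rhs"
  proof
    assume C: "?V = \<Union>?E \<and> min_dependent d p ?E"
    then have proper: "stress_free d p F" if "F \<subset> ?E" for F
      using that unfolding min_dependent_def by blast
    \<comment> \<open>If \<open>Ei\<close> contained all edges, then \<open>Vj\<close> would be covered by edges within \<open>Vi\<close>, and one graph would be a
      subgraph of the other.\<close>
    have one_side: "Ei - {{u, v}} \<subset> ?E"
      if "\<not> subgraph (Graph Vj Ej) (Graph Vi Ei)" "Ei \<union> Ej = ?E1 \<union> ?E2" "Vi \<union> Vj = ?V"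
        "{u, v} \<in> Ei" "Ei \<subseteq> all_pairs Vi" for Vi Vj Ei Ej
    proof (rule ccontr)
      assume "\<not> ?thesis"
      then have eq: "?E = Ei - {{u, v}}" using that(2) by blast
      then have "Ej \<subseteq> Ei" using that(2,4) by blast
      moreover have "\<Union>?E \<subseteq> Vi" unfolding eq using that(5) by (auto simp: all_pairs_def)
      then have "Vj \<subseteq> Vi" using that(3) C by blast
      ultimately show False using that(1) by (simp add: subgraph_def)
    qed
    have free: "stress_free d p (?E1 - {{u, v}})" "stress_free d p (?E2 - {{u, v}})"
      using one_side[of ?V2 ?E2 ?V1 ?E1] one_side[of ?V1 ?E1 ?V2 ?E2] assms(8,9) e E
      by (auto intro!: proper simp: Un_commute)
    obtain \<tau> f where \<tau>: "stress d p ?E \<tau>" "\<tau> f \<noteq> 0" using C min_dependentE by metis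
    have supp: "{f. \<tau> f \<noteq> 0} = ?E"
      using min_dependent_stress_support[OF _ _ \<tau>] C fin by simp
    have "stress d p (?E1 \<union> ?E2) \<tau>" using fin by (intro stress_mono[OF \<tau>(1)]) auto
    then obtain \<tau>1 \<tau>2 where split: "stress d p ?E1 \<tau>1" "stress d p ?E2 \<tau>2" "\<And>e. \<tau> e = \<tau>1 e + \<tau>2 e"
      using stress_split[OF V E _ indep] K by blast
    have "\<tau> {u, v} = 0" using \<tau>(1) by (simp add: stress_def)
    then have opp: "\<tau>2 {u, v} = - \<tau>1 {u, v}"
      using split(3) by (simp add: eq_neg_iff_add_eq_0 add.commute)
    have vanish: "\<sigma> f = 0" if "stress d p Ei \<sigma>" "\<sigma> {u, v} = 0" "stress_free d p (Ei - {{u, v}})" "finite Ei"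
      for Ei \<sigma>
    proof -
      have "stress d p (Ei - {{u, v}}) \<sigma>"
        using that(1,4) by (rule stressI_support) (use that stress_support[OF that(1)] in auto)
      then show ?thesis using that(3) by (simp add: stress_free_def)
    qed
    have nz: "\<tau>1 {u, v} \<noteq> 0"
    proof
      assume "\<tau>1 {u, v} = 0"
      then have "\<tau>1 f = 0" "\<tau>2 f = 0"
        using vanish[OF split(1) _ free(1) fin(1)] vanish[OF split(2) _ free(2) fin(2)] opp by auto
      then show False using split(3) \<tau>(2) by simp
    qed
    define \<omega>1 where "\<omega>1 h = (1 / \<tau>1 {u, v}) * \<tau>1 h + 0 * \<tau>1 h" for h
    define \<omega>2 where "\<omega>2 h = (1 / \<tau>2 {u, v}) * \<tau>2 h + 0 * \<tau>2 h" for h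
    have st1: "stress d p ?E1 \<omega>1"
      unfolding \<omega>1_def by (rule stress_lincomb[OF split(1) split(1)])
    have \<omega>1: "\<omega>1 {u, v} = 1" "\<And>h. \<omega>1 h \<noteq> 0 \<longleftrightarrow> \<tau>1 h \<noteq> 0"
      unfolding \<omega>1_def using nz by auto
    have st2: "stress d p ?E2 \<omega>2"
      unfolding \<omega>2_def by (rule stress_lincomb[OF split(2) split(2)])
    have \<omega>2: "\<omega>2 {u, v} = 1" "\<And>h. \<omega>2 h \<noteq> 0 \<longleftrightarrow> \<tau>2 h \<noteq> 0"
      unfolding \<omega>2_def using nz opp by auto
    have "h \<in> {f. \<omega>1 f \<noteq> 0 \<or> \<omega>2 f \<noteq> 0}" if "h \<in> ?E1 \<union> ?E2" for h
    proof (cases "h = {u, v}")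
      case False
      then have "\<tau> h \<noteq> 0" using supp that by blast
      then show ?thesis using split(3)[of h] \<omega>1(2) \<omega>2(2) by auto
    qed (simp add: \<omega>1(1))
    then have supp': "?E1 \<union> ?E2 = {f. \<omega>1 f \<noteq> 0 \<or> \<omega>2 f \<noteq> 0}"
      using stress_support[OF st1] stress_support[OF st2] by blast
    have cover: "?V = \<Union> (?E1 \<union> ?E2)" using C uv by blast
    show rhs unfolding rhs_def
      by (intro conjI exI[of _ \<omega>1] exI[of _ \<omega>2] free st1 st2 \<omega>1(1) \<omega>2(1) supp' cover)
  next
    assume rhs
    then obtain \<omega>1 \<omega>2 where free: "stress_free d p (?E1 - {{u, v}})" "stress_free d p (?E2 - {{u, v}})"
      and \<omega>1: "stress d p ?E1 \<omega>1" "\<omega>1 {u, v} = 1" and \<omega>2: "stress d p ?E2 \<omega>2" "\<omega>2 {u, v} = 1"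
      and supp: "?E1 \<union> ?E2 = {f. \<omega>1 f \<noteq> 0 \<or> \<omega>2 f \<noteq> 0}" and cover: "?V = \<Union> (?E1 \<union> ?E2)"
      unfolding rhs_def by blast
    \<comment> \<open>If \<open>\<omega>1 = \<omega>2\<close>, this would be a nonzero stress of the complete graph on \<open>?T\<close>.\<close>
    have dep: "\<not> stress_free d p ?E"
    proof
      assume free_E: "stress_free d p ?E"
      have diff: "stress d p (?E1 \<union> ?E2) (\<lambda>h. 1 * \<omega>1 h + (-1) * \<omega>2 h)"
        using fin by (intro stress_lincomb stress_mono[OF \<omega>1(1)] stress_mono[OF \<omega>2(1)]) auto
      have "stress d p ?E (\<lambda>h. 1 * \<omega>1 h + (-1) * \<omega>2 h)"
      proof (rule stressI_support[OF diff])
        fix h assume h: "1 * \<omega>1 h + (-1) * \<omega>2 h \<noteq> 0"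
        then have "h \<in> ?E1 \<union> ?E2" by (rule stress_support[OF diff])
        moreover have "h \<noteq> {u, v}" using h \<omega>1(2) \<omega>2(2) by auto
        ultimately show "h \<in> ?E" by blast
      qed (use fin in auto)
      then have "1 * \<omega>1 h + (-1) * \<omega>2 h = 0" for h
        using free_E unfolding stress_free_def by blast
      then have eq: "\<omega>1 h = \<omega>2 h" for h by simp
      have "stress d p (all_pairs ?T) \<omega>1"
      proof (rule stressI_support[OF \<omega>1(1) fin(1)])
        show "finite (all_pairs ?T)" using V by (simp add: finite_all_pairs)
        show "h \<in> all_pairs ?T" if "\<omega>1 h \<noteq> 0" for h
          using that stress_support[OF \<omega>1(1)] stress_support[OF \<omega>2(1)] eq[of h] K by auto
      qed
      then have "\<omega>1 {u, v} = 0"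
        using complete_graph_stress_free[OF _ indep] V unfolding stress_free_def by blast
      then show False using \<omega>1(2) by simp
    qed
    have "stress_free d p F" if F: "F \<subset> ?E" for F
    proof -
      obtain f where f: "f \<in> ?E" "f \<notin> F" using psubset_imp_ex_mem[OF F] by auto
      have f': "f \<in> ?E1 \<union> ?E2" "f \<noteq> {u, v}" using f(1) by simp_all
      moreover have "\<omega>1 f \<noteq> 0 \<or> \<omega>2 f \<noteq> 0" using f'(1) unfolding supp by simp
      ultimately have "stress_free d p (?E1 \<union> ?E2 - {{u, v}, f})"
        by (rule stress_free_union_minus_two_edges[OF V E K e p indep free \<omega>1 \<omega>2])
      moreover have "F \<subseteq> ?E1 \<union> ?E2 - {{u, v}, f}" using F f(2) by auto
      ultimately show ?thesis by (rule stress_free_subset) (simp add: fin)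
    qed
    then have "min_dependent d p ?E" using dep by (simp add: min_dependent_def)
    \<comment> \<open>Deleting \<open>{u, v}\<close> isolates neither \<open>u\<close> nor \<open>v\<close>: each meets another edge of the support of \<open>\<omega>1\<close>.\<close>
    moreover have "?V \<subseteq> \<Union>?E"
    proof
      fix w assume "w \<in> ?V"
      then obtain h where h: "h \<in> ?E1 \<union> ?E2" "w \<in> h" using cover by blast
      have another: "x \<in> \<Union>?E" if "{x, z} = {u, v}" for x z
      proof -
        have xz: "x \<noteq> z" "x \<in> ?T" "z \<in> ?T" using that uv by (auto simp: doubleton_eq_iff)
        obtain i where i: "i < d" "p x i \<noteq> p z i"
          using affinely_independent_distinct[OF indep _ xz] V by blast
        have "\<omega>1 {x, z} \<noteq> 0" using \<omega>1(2) that by simp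
        then obtain g where "g \<noteq> {x, z}" "\<omega>1 g \<noteq> 0" "x \<in> g"
          using stress_another_edge[OF \<omega>1(1) _ fin(1) xz(1) i] by blast
        then show ?thesis using that supp by blast
      qed
      show "w \<in> \<Union>?E"
      proof (cases "h = {u, v}")
        case True
        then show ?thesis using h(2) another[of u v] another[of v u] by (auto simp: insert_commute)
      qed (use h in blast)
    qed
    ultimately show "?V = \<Union>?E \<and> min_dependent d p ?E"
      using pairs by (auto simp: all_pairs_def)
  qed
  ultimately show ?thesis using circuit by blast
qed

end
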